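(* Let $\mathbb{F}$ be a finite field and let $C$ be a convolutional code over $\mathbb{F}$ of dimension $k$, length $n$ and degree $\delta$, with a canonical generator matrix $$G(z)=G_0+G_1z+\cdots+G_\delta z^\delta ,$$ where the $G_i$ are $k\times n$ matrices with entries in $\mathbb{F}$. Let $C^0\subseteq\mathbb{F}^n$ be the linear code defined as the image of the map $$\begin{pmatrix} G_\delta\\ G_{\delta-1}\\ \vdots\\ G_0\end{pmatrix}:\ \mathbb{F}^{k(\delta+1)}\to\mathbb{F}^n$$ (row vectors multiplied on the right by the matrix), and let $\nu$ and $\mu$ be the dimension and the (minimum Hamming) distance of $C^0$. If $\nu$ is maximal, i.e. $\nu=k(\delta+1)$, then $$d_{\mathrm{free}}(C)=d^r_{\operatorname{l}(C)},$$ where $$\operatorname{l}(C):=\left\lfloor \frac1\mu\Big((n-k)\big(\lfloor \delta/k\rfloor+1\big)+\delta+1\Big)\right\rfloor-(\delta+1)$$ and $d^r_l$ denotes the $l$-th row distance.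
   Context: A convolutional code of length $n$ and dimension $k$ over $\mathbb{F}$ is a $k$-dimensional $\mathbb{F}(z)$-subspace of $\mathbb{F}(z)^n$. A generator matrix is a $k\times n$ matrix $G(z)$ with entries in $\mathbb{F}[z]$ whose rows form a basis of it. It is basic if its maximal ($k\times k$) minors are coprime polynomials in $z$; it is reduced if its row degrees (the row degree is the maximal degree of the entries of a row) cannot be lowered by elementary row operations over $\mathbb{F}[z]$; it is canonical if it is basic and reduced. The row degrees of a canonical generator matrix are invariants of the code up to order (the Forney indices); their sum is the degree $\delta$ of the code. The weight of a polynomial vector in $\mathbb{F}[z]^n$ is the total number of non-zero coefficients of its entries. The free distance $d_{\mathrm{free}}(C)$ is the minimum weight of a non-zero word of the $\mathbb{F}[z]$-module $\{\alpha(z)G(z):\alpha(z)\in\mathbb{F}[z]^k\}$, with $G(z)$ a canonical generator matrix. For $l\ge 0$, the $l$-th row distance $d^r_l$ is the minimum Hamming distance of the linear block code $C_l\subseteq\mathbb{F}^{n(\delta+l+1)}$ which is the row space of the $k(l+1)\times n(\delta+l+1)$ matrix $$\begin{pmatrix} G_0&\dots&G_\delta&0&\dots&0\\ 0&G_0&\dots&G_\delta&\ddots&\vdots\\ \vdots&\ddots&\ddots&&\ddots&0\\ 0&\dots&0&G_0&\dots&G_\delta\end{pmatrix}.$$ Equivalently, $d^r_l$ is the minimum weight of $\alpha(z)G(z)$ over non-zero $\alpha(z)\in\mathbb{F}[z]^k$ of degree at most $l$. *)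

theory Defs
  imports
    "HOL-Computational_Algebra.Polynomial_Factorial"
    "Jordan_Normal_Form.VS_Connect"
    "Jordan_Normal_Form.Gauss_Jordan_Elimination"
    "Jordan_Normal_Form.DL_Submatrix"
begin

section \<open>Vectors and block codes\<close>

text \<open>Messages are row vectors acting from the left, as usual in coding theory; the library
  only has matrices acting on column vectors.\<close>

definition row_mult :: "'a :: comm_semiring_0 vec \<Rightarrow> 'a mat \<Rightarrow> 'a vec"
  where "row_mult \<alpha> M = transpose_mat M *\<^sub>v \<alpha>"

definition vec_subspace :: "nat \<Rightarrow> 'a :: field vec set \<Rightarrow> bool"
  where "vec_subspace n W \<longleftrightarrow> VectorSpace.subspace class_ring W (module_vec TYPE('a) n)"

definition vec_dim :: "nat \<Rightarrow> 'a :: field vec set \<Rightarrow> nat"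
  where "vec_dim n W = vectorspace.dim class_ring ((module_vec TYPE('a) n)\<lparr>carrier := W\<rparr>)"

definition vec_basis :: "nat \<Rightarrow> 'a :: field vec set \<Rightarrow> 'a vec set \<Rightarrow> bool"
  where "vec_basis n W B \<longleftrightarrow>
    vectorspace.basis class_ring ((module_vec TYPE('a) n)\<lparr>carrier := W\<rparr>) B"

definition hamming_distance :: "'a vec \<Rightarrow> 'a vec \<Rightarrow> nat"
  where "hamming_distance u v = card {i. i < dim_vec u \<and> u $ i \<noteq> v $ i}"

definition min_distance :: "'a vec set \<Rightarrow> nat"
  where "min_distance B =
    (LEAST d. \<exists>u \<in> B. \<exists>v \<in> B. u \<noteq> v \<and> d = hamming_distance u v)"

section \<open>Convolutional codes and canonical generator matrices\<close>

definition convolutional_code :: "nat \<Rightarrow> nat \<Rightarrow> 'a :: field poly fract vec set \<Rightarrow> bool"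
  where "convolutional_code n k C \<longleftrightarrow> vec_subspace n C \<and> vec_dim n C = k"

definition generator_matrix ::
  "nat \<Rightarrow> nat \<Rightarrow> 'a :: field poly fract vec set \<Rightarrow> 'a poly mat \<Rightarrow> bool"
  where "generator_matrix n k C G \<longleftrightarrow>
    G \<in> carrier_mat k n \<and>
    distinct (rows (map_mat to_fract G)) \<and>
    vec_basis n C (set (rows (map_mat to_fract G)))"

definition basic_matrix :: "'a :: field poly mat \<Rightarrow> bool"
  where "basic_matrix G \<longleftrightarrow>
    (\<forall>p. (\<forall>S \<subseteq> {..<dim_col G}. card S = dim_row G \<longrightarrow> p dvd det (submatrix G UNIV S))
         \<longrightarrow> is_unit p)"

definition row_degree :: "'a :: zero poly mat \<Rightarrow> nat \<Rightarrow> nat"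
  where "row_degree G i = Max {degree (G $$ (i, j)) | j. j < dim_col G}"

definition row_degree_sum :: "'a :: zero poly mat \<Rightarrow> nat"
  where "row_degree_sum G = (\<Sum>i < dim_row G. row_degree G i)"

inductive elem_row_op :: "'a :: comm_ring_1 mat \<Rightarrow> 'a mat \<Rightarrow> bool"
  where
    swap: "i < dim_row G \<Longrightarrow> j < dim_row G \<Longrightarrow> elem_row_op G (swaprows i j G)"
  | scale: "i < dim_row G \<Longrightarrow> c dvd 1 \<Longrightarrow> elem_row_op G (multrow i c G)"
  | add: "i < dim_row G \<Longrightarrow> j < dim_row G \<Longrightarrow> i \<noteq> j \<Longrightarrow> elem_row_op G (addrow c i j G)"

text \<open>Row degrees are compared through their sum, since row operations may permute the rows.\<close>

definition reduced_matrix :: "'a :: field poly mat \<Rightarrow> bool"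
  where "reduced_matrix G \<longleftrightarrow>
    (\<forall>H. elem_row_op\<^sup>*\<^sup>* G H \<longrightarrow> row_degree_sum G \<le> row_degree_sum H)"

definition canonical_generator_matrix ::
  "nat \<Rightarrow> nat \<Rightarrow> 'a :: field poly fract vec set \<Rightarrow> 'a poly mat \<Rightarrow> bool"
  where "canonical_generator_matrix n k C G \<longleftrightarrow>
    generator_matrix n k C G \<and> basic_matrix G \<and> reduced_matrix G"

text \<open>The degree and the free distance are invariants of the code: they do not depend on which
  canonical generator matrix is chosen.\<close>

definition some_canonical :: "nat \<Rightarrow> nat \<Rightarrow> 'a :: field poly fract vec set \<Rightarrow> 'a poly mat"
  where "some_canonical n k C = (SOME G. canonical_generator_matrix n k C G)"

definition code_degree :: "nat \<Rightarrow> nat \<Rightarrow> 'a :: field poly fract vec set \<Rightarrow> nat"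
  where "code_degree n k C = row_degree_sum (some_canonical n k C)"

section \<open>Free distance and row distances\<close>

definition poly_weight :: "'a :: zero poly vec \<Rightarrow> nat"
  where "poly_weight v = (\<Sum>j < dim_vec v. card {i. coeff (v $ j) i \<noteq> 0})"

definition poly_row_module :: "'a :: comm_semiring_0 poly mat \<Rightarrow> 'a poly vec set"
  where "poly_row_module G = {row_mult \<alpha> G | \<alpha>. \<alpha> \<in> carrier_vec (dim_row G)}"

definition free_distance :: "nat \<Rightarrow> nat \<Rightarrow> 'a :: field poly fract vec set \<Rightarrow> nat"
  where "free_distance n k C =
    (LEAST d. \<exists>v \<in> poly_row_module (some_canonical n k C). v \<noteq> 0\<^sub>v n \<and> d = poly_weight v)"

definition coeff_mat :: "'a :: zero poly mat \<Rightarrow> nat \<Rightarrow> 'a mat"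
  where "coeff_mat G i = map_mat (\<lambda>p. coeff p i) G"

text \<open>Block row \<open>r\<close> of the sliding matrix carries the coefficient matrices \<open>G\<^sub>0, \<dots>, G\<^sub>\<delta>\<close> in the
  block columns \<open>r, \<dots>, r + \<delta>\<close>; blocks have size \<open>dim_row G \<times> dim_col G\<close>.\<close>

definition sliding_matrix :: "'a :: zero poly mat \<Rightarrow> nat \<Rightarrow> nat \<Rightarrow> 'a mat"
  where "sliding_matrix G \<delta> l =
    (let k = dim_row G; n = dim_col G in
     mat (k * (l + 1)) (n * (\<delta> + l + 1))
       (\<lambda>(i, j). let r = i div k; c = j div n in
          if r \<le> c \<and> c \<le> r + \<delta> then coeff_mat G (c - r) $$ (i mod k, j mod n) else 0))"

definition row_distance :: "'a :: field poly mat \<Rightarrow> nat \<Rightarrow> nat \<Rightarrow> nat"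
  where "row_distance G \<delta> l =
    min_distance (vec_space.row_space (dim_col G * (\<delta> + l + 1)) (sliding_matrix G \<delta> l))"

section \<open>The block code of the stacked coefficient matrices\<close>

text \<open>From top to bottom the blocks are \<open>G\<^sub>\<delta>, G\<^bsub>\<delta>-1\<^esub>, \<dots>, G\<^sub>0\<close>.\<close>

definition stacked_matrix :: "'a :: zero poly mat \<Rightarrow> nat \<Rightarrow> 'a mat"
  where "stacked_matrix G \<delta> =
    (let k = dim_row G in
     mat (k * (\<delta> + 1)) (dim_col G)
       (\<lambda>(i, j). coeff_mat G (\<delta> - i div k) $$ (i mod k, j)))"

definition stacked_code :: "'a :: field poly mat \<Rightarrow> nat \<Rightarrow> 'a vec set"
  where "stacked_code G \<delta> =
    (\<lambda>\<alpha>. row_mult \<alpha> (stacked_matrix G \<delta>)) ` carrier_vec (dim_row G * (\<delta> + 1))"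

definition row_index :: "nat \<Rightarrow> nat \<Rightarrow> nat \<Rightarrow> nat \<Rightarrow> int"
  where "row_index n k \<delta> \<mu> =
    \<lfloor>1 / real \<mu> *
      ((real n - real k) * (real_of_int \<lfloor>real \<delta> / real k\<rfloor> + 1) + real \<delta> + 1)\<rfloor>
    - (int \<delta> + 1)"

end

theory Submission
  imports Defs "Jordan_Normal_Form.DL_Rank" "Subresultants.More_Homomorphisms"
begin

text \<open>The coefficient of \<open>z\<^sup>s\<close> in \<open>\<alpha>(z) G(z)\<close> is the image of the window
  \<open>(\<alpha>\<^bsub>s-\<delta>\<^esub>, \<dots>, \<alpha>\<^sub>s)\<close> under the stacked matrix, hence a word of \<open>C\<^sup>0\<close>. When \<open>\<nu>\<close> is maximal, it has
  weight at least \<open>\<mu>\<close> unless the window vanishes. Take a word of minimal weight whose message has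
  minimal degree \<open>L\<close>. No window at \<open>0, \<dots>, L + \<delta>\<close> vanishes, since otherwise the tail of the message
  behind it would give a shorter message of no larger weight. So \<open>\<mu> (L + \<delta> + 1)\<close> is at most the free
  distance, which is bounded above by the generalised Singleton bound, and \<open>L \<le> l(C)\<close> follows.

  Maximality of \<open>\<nu>\<close> also makes every row degree equal to \<open>\<delta>\<close>, which is their sum, so \<open>k = 1\<close> or
  \<open>\<delta> = 0\<close>; in these two cases the generalised Singleton bound is elementary. The degree and the
  free distance are defined by an arbitrary canonical generator matrix, so their invariance is
  needed: basic matrices of the same code differ by a unimodular factor, and the predictable degree
  property of reduced matrices compares the row degrees along a nonzero term of its determinant.\<close>

section \<open>Row spaces and linear independence\<close>

lemma dim_row_mult [simp]: "dim_vec (row_mult \<alpha> G) = dim_col G"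
  by (simp add: row_mult_def)

lemma row_mult_carrier [simp]: "G \<in> carrier_mat k n \<Longrightarrow> row_mult \<alpha> G \<in> carrier_vec n"
  by (auto intro: carrier_vecI)

lemma row_mult_index:
  assumes "G \<in> carrier_mat k n" "\<alpha> \<in> carrier_vec k" "j < n"
  shows "row_mult \<alpha> G $ j = (\<Sum>i<k. \<alpha> $ i * G $$ (i, j))"
  using assms
  by (auto simp: row_mult_def scalar_prod_def atLeast0LessThan mult.commute intro!: sum.cong)

lemma row_mult_row_mult:
  fixes G T :: "'a :: comm_semiring_0 mat"
  assumes "T \<in> carrier_mat m k" "G \<in> carrier_mat k n" "\<beta> \<in> carrier_vec m"
  shows "row_mult (row_mult \<beta> T) G = row_mult \<beta> (T * G)"
  using assms by (simp add: row_mult_def transpose_mult[of T m k G n]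
    assoc_mult_mat_vec[of "G\<^sup>T" n k "T\<^sup>T" m])

lemma row_row_mult:
  fixes G T :: "'a :: comm_semiring_0 mat"
  assumes "T \<in> carrier_mat m k" "G \<in> carrier_mat k n" "i < m"
  shows "row (T * G) i = row_mult (row T i) G"
  using assms by (intro eq_vecI)
    (auto simp: row_mult_index[OF assms(2)] scalar_prod_def atLeast0LessThan intro!: sum.cong)

lemma row_mult_map_to_fract:
  fixes G :: "'a :: idom mat"
  assumes "G \<in> carrier_mat k n" "\<alpha> \<in> carrier_vec k"
  shows "row_mult (map_vec to_fract \<alpha>) (map_mat to_fract G) = map_vec to_fract (row_mult \<alpha> G)"
  using assms by (intro eq_vecI) (auto simp: row_mult_index[of _ k n] to_fract_hom.hom_sum)

lemma row_mult_diff: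
  fixes G :: "'a :: comm_ring mat"
  assumes "G \<in> carrier_mat k n" "u \<in> carrier_vec k" "v \<in> carrier_vec k"
  shows "row_mult (u - v) G = row_mult u G - row_mult v G"
  using assms by (intro eq_vecI)
    (auto simp: row_mult_index[of G k n] left_diff_distrib sum_subtractf)

lemma row_mult_zero [simp]:
  assumes "G \<in> carrier_mat k n"
  shows "row_mult (0\<^sub>v k) G = 0\<^sub>v n"
  using assms by (intro eq_vecI) (auto simp: row_mult_index[of G k n])

text \<open>Phrased through the left kernel, so that one notion serves matrices over F[z], over F(z)
  and over F. Repeated rows count as dependent, unlike for linear independence of the set of
  rows.\<close>

definition indep_rows :: "'a :: comm_semiring_0 mat \<Rightarrow> bool" where
  "indep_rows G \<longleftrightarrow>
    (\<forall>\<alpha> \<in> carrier_vec (dim_row G). row_mult \<alpha> G = 0\<^sub>v (dim_col G) \<longrightarrow> \<alpha> = 0\<^sub>v (dim_row G))"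

lemma indep_rowsD:
  assumes "indep_rows G" "G \<in> carrier_mat k n" "\<alpha> \<in> carrier_vec k" "row_mult \<alpha> G = 0\<^sub>v n"
  shows "\<alpha> = 0\<^sub>v k"
  using assms by (auto simp: indep_rows_def)

lemma indep_rows_inj:
  fixes G :: "'a :: comm_ring mat"
  assumes "indep_rows G" "G \<in> carrier_mat k n" "u \<in> carrier_vec k" "v \<in> carrier_vec k"
    and eq: "row_mult u G = row_mult v G"
  shows "u = v"
proof -
  have "row_mult (u - v) G = row_mult v G - row_mult v G"
    using assms(2-4) by (simp add: row_mult_diff[of G k n] eq)
  then have "row_mult (u - v) G = 0\<^sub>v n"
    using assms(2) by (simp add: minus_cancel_vec[of _ n])
  then have 0: "u - v = 0\<^sub>v k"
    using assms(3,4) by (intro indep_rowsD[OF assms(1,2)]) auto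
  show ?thesis
  proof (rule eq_vecI)
    fix i assume "i < dim_vec v"
    then show "u $ i = v $ i"
      using assms(3,4) arg_cong[OF 0, of "\<lambda>w. w $ i"] by simp
  qed (use assms in auto)
qed

lemma vectorspace_class_ring_submodule:
  "vec_subspace n C \<Longrightarrow> vectorspace class_ring ((module_vec TYPE('a :: field) n)\<lparr>carrier := C\<rparr>)"
  unfolding vec_subspace_def
  by (rule vectorspace.subspace_is_vs[OF vec_vs])

text \<open>Span and independence inside the subspace \<open>C\<close> agree with those in the
  ambient space, and distinctness of the rows lets their set stand for their list.\<close>

lemma vec_basis_rows:
  fixes A :: "'a :: field mat"
  assumes A: "A \<in> carrier_mat k n" and C: "vec_subspace n C"
    and dist: "distinct (rows A)" and B: "vec_basis n C (set (rows A))"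
  shows "C = {row_mult x A | x. x \<in> carrier_vec k}" "indep_rows A"
proof -
  interpret V: vec_space "TYPE('a)" n .
  have sub: "submodule class_ring C V.V"
    using C by (simp add: vec_subspace_def VectorSpace.subspace_def)
  interpret W: vectorspace class_ring "V.V\<lparr>carrier := C\<rparr>"
    by (rule vectorspace_class_ring_submodule[OF C])
  have rC: "set (rows A) \<subseteq> C"
    and li: "W.lin_indpt (set (rows A))" and gen: "W.gen_set (set (rows A))"
    using B unfolding vec_basis_def W.basis_def by auto
  have "V.span (set (rows A)) = C"
    using gen V.span_li_not_depend(1)[OF rC sub] by simp
  then have "C = V.row_space A"
    by (simp add: V.row_space_def)
  also have "\<dots> = {row_mult x A | x. x \<in> carrier_vec k}"
    using A by (auto simp: V.row_space_eq[OF A] row_mult_def)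
  finally show "C = {row_mult x A | x. x \<in> carrier_vec k}" .
  have li': "V.lin_indpt (set (rows A))"
    using li V.span_li_not_depend(2)[OF rC sub] by simp
  show "indep_rows A"
    unfolding indep_rows_def
  proof (intro ballI impI, rule ccontr)
    fix x assume x: "x \<in> carrier_vec (dim_row A)" "row_mult x A = 0\<^sub>v (dim_col A)"
      "x \<noteq> 0\<^sub>v (dim_row A)"
    then have "V.lin_dep (set (cols A\<^sup>T))"
      using A dist by (intro V.lin_depI[of "A\<^sup>T" k x]) (auto simp: row_mult_def)
    then show False
      using li' by simp
  qed
qed

text \<open>This brings the maximality of \<nu> into usable form. With repeated columns of the
  transpose, a maximal independent set of columns would have fewer than \<open>m\<close> elements,
  against rank \<open>m\<close>; once the columns are distinct, full rank means
  independence.\<close>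

lemma full_dim_indep_rows:
  fixes A :: "'a :: field mat"
  assumes A: "A \<in> carrier_mat m n"
    and dim: "vec_dim n ((\<lambda>\<alpha>. row_mult \<alpha> A) ` carrier_vec m) = m"
  shows "indep_rows A"
proof -
  interpret V: vec_space "TYPE('a)" n .
  have AT: "A\<^sup>T \<in> carrier_mat n m"
    using A by simp
  have "(\<lambda>\<alpha>. row_mult \<alpha> A) ` carrier_vec m = V.span (set (cols A\<^sup>T))"
    using A V.col_space_eq[OF AT] by (auto simp: V.col_space_def row_mult_def)
  then have rk: "V.rank A\<^sup>T = m"
    using dim by (simp add: V.rank_def vec_dim_def)
  have dist: "distinct (cols A\<^sup>T)"
  proof (rule ccontr)
    assume nd: "\<not> distinct (cols A\<^sup>T)"
    obtain S where S: "maximal S (\<lambda>T. T \<subseteq> set (cols A\<^sup>T) \<and> V.lin_indpt T)"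
      using maximal_exists[of "(\<lambda>T. T \<subseteq> set (cols A\<^sup>T) \<and> V.lin_indpt T)" "card (set (cols A\<^sup>T))" "{}"]
      by (meson List.finite_set card_mono empty_iff empty_subsetI V.finite_lin_indpt2 rev_finite_subset)
    have "card S \<le> card (set (cols A\<^sup>T))"
      using S by (intro card_mono) (auto simp: maximal_def)
    also have "\<dots> < length (cols A\<^sup>T)"
      using nd card_distinct card_length le_neq_implies_less by blast
    finally show False
      using V.rank_card_indpt[OF AT S] rk A by simp
  qed
  have li: "V.lin_indpt (set (cols A\<^sup>T))"
    by (rule V.full_rank_lin_indpt[OF AT rk dist])
  show ?thesis
    unfolding indep_rows_def
  proof (intro ballI impI, rule ccontr)
    fix x assume x: "x \<in> carrier_vec (dim_row A)" "row_mult x A = 0\<^sub>v (dim_col A)"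
      "x \<noteq> 0\<^sub>v (dim_row A)"
    then have "V.lin_dep (set (cols A\<^sup>T))"
      using A dist by (intro V.lin_depI[of "A\<^sup>T" m x]) (auto simp: row_mult_def)
    then show False
      using li by simp
  qed
qed

section \<open>Denominators of rational functions and basic matrices\<close>

text \<open>The denominators of \<open>x\<close>, together with 0, form an ideal of F[z]. Its
  generator \<open>b\<close> is a nonzero denominator of least degree: the remainder
  \<open>p mod b\<close> of a denominator \<open>p\<close> is again a denominator, so it must
  vanish.\<close>

lemma fract_denominator:
  fixes x :: "'a :: field poly fract"
  obtains b q where "b \<noteq> 0" "to_fract b * x = to_fract q"
    and "\<And>p r. to_fract p * x = to_fract r \<Longrightarrow> b dvd p"
proof -
  let ?P = "\<lambda>b. b \<noteq> 0 \<and> (\<exists>q. to_fract b * x = to_fract q)"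
  obtain c d where "x = Fract c d" "d \<noteq> 0"
    by (cases x) auto
  then have "to_fract d * x = to_fract c"
    by (simp add: to_fract_def eq_fract)
  then have ex: "?P d"
    using \<open>d \<noteq> 0\<close> by auto
  define b where "b = (ARG_MIN degree b. ?P b)"
  have b: "?P b" and min: "\<And>p. ?P p \<Longrightarrow> degree b \<le> degree p"
    using arg_min_nat_lemma[of ?P d degree] ex unfolding b_def by blast+
  obtain q where q: "to_fract b * x = to_fract q"
    using b by auto
  have "b dvd p" if p: "to_fract p * x = to_fract r" for p r
  proof (rule ccontr)
    assume "\<not> b dvd p"
    then have nz: "p mod b \<noteq> 0"
      by (simp add: dvd_eq_mod_eq_0)
    have "to_fract (p mod b) * x = to_fract (p - (p div b) * b) * x"
      by (simp add: minus_div_mult_eq_mod)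
    also have "\<dots> = to_fract p * x - to_fract (p div b) * (to_fract b * x)"
      by (simp add: algebra_simps)
    also have "\<dots> = to_fract (r - (p div b) * q)"
      by (simp add: p q)
    finally have "\<exists>q. to_fract (p mod b) * x = to_fract q"
      by (rule exI)
    then have "degree b \<le> degree (p mod b)"
      using nz min by simp
    then show False
      using degree_mod_less'[of b p] b nz by simp
  qed
  then show thesis
    using that b q by blast
qed

text \<open>Cramer's rule shows that every maximal minor is a denominator of every entry of \<open>x\<close>.\<close>

lemma basic_matrix_poly_solution:
  fixes G :: "'a :: field poly mat"
  assumes G: "G \<in> carrier_mat k n" and basic: "basic_matrix G"
    and x: "x \<in> carrier_vec k" and y: "y \<in> carrier_vec n"
    and eq: "row_mult x (map_mat to_fract G) = map_vec to_fract y"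
  obtains a where "a \<in> carrier_vec k" "x = map_vec to_fract a"
proof -
  have "\<exists>p. x $ i = to_fract p" if i: "i < k" for i
  proof -
    obtain b q where b: "b \<noteq> 0" "to_fract b * x $ i = to_fract q"
      and dvd: "\<And>p r. to_fract p * x $ i = to_fract r \<Longrightarrow> b dvd p"
      using fract_denominator[of "x $ i"] by blast
    \<comment> \<open>The least denominator \<open>b\<close> of one coordinate of \<open>x\<close>
      is shown to be a common divisor of the maximal minors; basicness then forces it to be a
      unit.\<close>
    have "b dvd det (submatrix G UNIV S)" if S: "S \<subseteq> {..<n}" "card S = k" for S
    proof -
      have cS: "card {j. j < n \<and> j \<in> S} = k"
        using S by (metis Collect_conj_eq Collect_mem_eq inf.absorb2 lessThan_def)
      define M where "M = submatrix G UNIV S"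
      have M: "M \<in> carrier_mat k k"
        using G cS by (auto simp: M_def dim_submatrix)
      have pick: "pick S j < n" if "j < k" for j
        using pick_le[of j n S] cS that by simp
      have M_ij: "M $$ (i, j) = G $$ (i, pick S j)" if "i < k" "j < k" for i j
        using that G cS by (simp add: M_def submatrix_index pick_UNIV)
      define w where "w = vec k (\<lambda>j. y $ pick S j)"
      have w: "w \<in> carrier_vec k" by (simp add: w_def)
      let ?N = "M\<^sup>T"
      let ?h = "map_mat to_fract"
      have N: "?N \<in> carrier_mat k k" using M by simp
      \<comment> \<open>Only the equations for the columns in \<open>S\<close> are kept, which
        leaves a square system with polynomial right-hand side.\<close>
      have Nx: "?h ?N *\<^sub>v x = map_vec to_fract w"
      proof (rule eq_vecI)
        fix j assume "j < dim_vec (map_vec to_fract w)"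
        then have j: "j < k" by (simp add: w_def)
        have "row_mult x (?h G) $ pick S j = to_fract (y $ pick S j)"
          using eq pick[OF j] y by simp
        moreover have "row_mult x (?h G) $ pick S j = (\<Sum>i<k. x $ i * to_fract (G $$ (i, pick S j)))"
          using G pick[OF j] by (subst row_mult_index[of _ k n]) (auto simp: x)
        moreover have "(?h ?N *\<^sub>v x) $ j = (\<Sum>i<k. x $ i * to_fract (G $$ (i, pick S j)))"
          using M x j
          by (auto simp: scalar_prod_def atLeast0LessThan M_ij mult.commute intro!: sum.cong)
        ultimately show "(?h ?N *\<^sub>v x) $ j = map_vec to_fract w $ j"
          using j by (simp add: w_def)
      qed (use M in \<open>auto simp: w_def\<close>)
      note adj = adj_mat[OF N]
      have "?h (adj_mat ?N * ?N) = ?h (adj_mat ?N) * ?h ?N"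
        by (rule to_fract_hom.mat_hom_mult[OF adj(1) N])
      then have mat: "?h (adj_mat ?N) * ?h ?N = ?h (det ?N \<cdot>\<^sub>m 1\<^sub>m k)"
        by (simp add: adj(3))
      \<comment> \<open>Multiplying the square system by the adjugate shows that
        \<open>det ?N\<close> times \<open>x\<close> is a polynomial vector.\<close>
      have "map_vec to_fract (adj_mat ?N *\<^sub>v w) = ?h (adj_mat ?N) *\<^sub>v map_vec to_fract w"
        by (rule to_fract_hom.mult_mat_vec_hom[OF adj(1) w])
      also have "\<dots> = (?h (adj_mat ?N) * ?h ?N) *\<^sub>v x"
        using adj(1) N x by (simp add: Nx[symmetric] assoc_mult_mat_vec[of _ k k _ k])
      also have "\<dots> = ?h (det ?N \<cdot>\<^sub>m 1\<^sub>m k) *\<^sub>v x"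
        by (simp only: mat)
      finally have "map_vec to_fract (adj_mat ?N *\<^sub>v w) $ i = (?h (det ?N \<cdot>\<^sub>m 1\<^sub>m k) *\<^sub>v x) $ i"
        by simp
      moreover have "(?h (det ?N \<cdot>\<^sub>m 1\<^sub>m k) *\<^sub>v x) $ i
          = (\<Sum>j<k. if j = i then to_fract (det ?N) * x $ j else 0)"
        using i x by (auto simp del: sum.delta sum.delta'
          simp: scalar_prod_def atLeast0LessThan intro!: sum.cong)
      ultimately have "to_fract (det ?N) * x $ i = to_fract ((adj_mat ?N *\<^sub>v w) $ i)"
        using i adj(1) by simp
      then have "b dvd det ?N"
        by (rule dvd)
      then show ?thesis
        using det_transpose[OF M] by (simp add: M_def)
    qed
    then have "is_unit b"
      using basic G by (auto simp: basic_matrix_def)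
    then obtain c where "1 = b * c" by (elim dvdE)
    have "x $ i = to_fract (b * c) * x $ i"
      by (simp flip: \<open>1 = b * c\<close>)
    also have "\<dots> = to_fract c * (to_fract b * x $ i)"
      by (simp add: mult_ac)
    also have "\<dots> = to_fract (c * q)"
      by (simp only: b(2) to_fract_mult)
    finally have "x $ i = to_fract (c * q)" .
    then show ?thesis ..
  qed
  then obtain f where f: "\<And>i. i < k \<Longrightarrow> x $ i = to_fract (f i)"
    by metis
  show thesis
    by (rule that[of "vec k f"]) (use f x in \<open>auto\<close>)
qed

section \<open>Canonical generator matrices of the same code\<close>

lemma generator_matrixD:
  fixes G :: "'a :: field poly mat"
  assumes C: "vec_subspace n C" and gen: "generator_matrix n k C G"
  shows "G \<in> carrier_mat k n"
    and "C = {row_mult x (map_mat to_fract G) | x. x \<in> carrier_vec k}"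
    and "set (rows (map_mat to_fract G)) \<subseteq> C"
    and "indep_rows G"
proof -
  let ?F = "map_mat to_fract G"
  show G: "G \<in> carrier_mat k n"
    using gen by (simp add: generator_matrix_def)
  then have F: "?F \<in> carrier_mat k n" by simp
  have dist: "distinct (rows ?F)" and B: "vec_basis n C (set (rows ?F))"
    using gen by (auto simp: generator_matrix_def)
  show "C = {row_mult x ?F | x. x \<in> carrier_vec k}"
    by (rule vec_basis_rows(1)[OF F C dist B])
  interpret W: vectorspace class_ring "(module_vec TYPE('a poly fract) n)\<lparr>carrier := C\<rparr>"
    by (rule vectorspace_class_ring_submodule[OF C])
  show "set (rows ?F) \<subseteq> C"
    using B unfolding vec_basis_def W.basis_def by auto
  have ind: "indep_rows ?F"
    by (rule vec_basis_rows(2)[OF F C dist B])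
  show "indep_rows G"
    unfolding indep_rows_def
  proof (intro ballI impI)
    fix a assume a: "a \<in> carrier_vec (dim_row G)" and 0: "row_mult a G = 0\<^sub>v (dim_col G)"
    have ak: "a \<in> carrier_vec k"
      using a G by simp
    have "row_mult (map_vec to_fract a) ?F = 0\<^sub>v n"
      using G 0 by (subst row_mult_map_to_fract[OF G ak]) auto
    then have "map_vec to_fract a = 0\<^sub>v k"
      using ak by (intro indep_rowsD[OF ind F]) auto
    then have "a = 0\<^sub>v k"
      by (simp add: to_fract_hom.vec_hom_zero_iff)
    then show "a = 0\<^sub>v (dim_row G)"
      using G by simp
  qed
qed

text \<open>Each row of \<open>H\<close> lies in \<open>C\<close>, so it is a combination over F(z)
  of the rows of \<open>G\<close>. Since \<open>G\<close> is basic, the coefficients are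
  polynomials, and they form the rows of \<open>T\<close>.\<close>

lemma basic_generator_factor:
  fixes G H :: "'a :: field poly mat"
  assumes C: "vec_subspace n C" and G: "generator_matrix n k C G" and basic: "basic_matrix G"
    and H: "generator_matrix n k C H"
  obtains T where "T \<in> carrier_mat k k" "H = T * G"
proof -
  note G' = generator_matrixD[OF C G] and H' = generator_matrixD[OF C H]
  have "\<exists>a. a \<in> carrier_vec k \<and> row_mult a G = row H i" if i: "i < k" for i
  proof -
    have rH: "row H i \<in> carrier_vec n"
      using H'(1) i by auto
    have "map_vec to_fract (row H i) = row (map_mat to_fract H) i"
      using H'(1) i by (intro eq_vecI) auto
    also have "\<dots> \<in> C"
      using H'(1,3) i by (auto simp: rows_def)
    finally obtain x where x: "x \<in> carrier_vec k"
      and eq: "row_mult x (map_mat to_fract G) = map_vec to_fract (row H i)"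
      using G'(2) by auto
    obtain a where a: "a \<in> carrier_vec k" "x = map_vec to_fract a"
      using basic_matrix_poly_solution[OF G'(1) basic x rH eq] by blast
    have "map_vec to_fract (row_mult a G) = map_vec to_fract (row H i)"
      using eq by (simp only: a(2) row_mult_map_to_fract[OF G'(1) a(1)])
    then have "row_mult a G = row H i"
      by (rule to_fract_hom.vec_hom_inj)
    then show ?thesis
      using a by blast
  qed
  then obtain a where a: "\<And>i. i < k \<Longrightarrow> a i \<in> carrier_vec k"
    "\<And>i. i < k \<Longrightarrow> row_mult (a i) G = row H i"
    by metis
  let ?T = "mat k k (\<lambda>(i, j). a i $ j)"
  have T: "?T \<in> carrier_mat k k" by simp
  have "H = ?T * G"
  proof (rule eq_rowI)
    fix i assume "i < dim_row (?T * G)"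
    then have i: "i < k" by simp
    have "row ?T i = a i"
      using a(1)[OF i] i by (intro eq_vecI) auto
    then show "row H i = row (?T * G) i"
      using row_row_mult[OF T G'(1) i] a(2)[OF i] by simp
  qed (use G'(1) H'(1) in auto)
  then show thesis
    using that T by blast
qed

text \<open>Both \<open>T' * T\<close> and the identity fix \<open>G\<close> from the left, and
  independent rows admit only one such combination. This is how transition matrices are seen to be
  unimodular.\<close>

lemma indep_rows_left_inverse:
  fixes G H T T' :: "'a :: comm_ring_1 mat"
  assumes G: "G \<in> carrier_mat k n" "indep_rows G"
    and T: "T \<in> carrier_mat k k" "H = T * G" and T': "T' \<in> carrier_mat k k" "G = T' * H"
  shows "T' * T = 1\<^sub>m k"
proof (rule eq_rowI)
  fix i assume "i < dim_row (1\<^sub>m k)"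
  then have i: "i < k" by simp
  have TT: "T' * T \<in> carrier_mat k k"
    using T(1) T'(1) by simp
  have "row_mult (row (T' * T) i) G = row ((T' * T) * G) i"
    by (rule row_row_mult[symmetric, OF TT G(1) i])
  also have "(T' * T) * G = 1\<^sub>m k * G"
    by (simp only: assoc_mult_mat[OF T'(1) T(1) G(1)] left_mult_one_mat[OF G(1)]
      flip: T(2) T'(2))
  also have "row (1\<^sub>m k * G) i = row_mult (row (1\<^sub>m k) i) G"
    by (rule row_row_mult[OF one_carrier_mat G(1) i])
  finally have eq: "row_mult (row (T' * T) i) G = row_mult (row (1\<^sub>m k) i) G" .
  show "row (T' * T) i = row (1\<^sub>m k) i"
    by (rule indep_rows_inj[OF G(2,1) _ _ eq]) (use TT i in auto)
qed (use T(1) T'(1) in auto)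

lemma poly_row_module_mult:
  assumes T: "T \<in> carrier_mat m k" and G: "G \<in> carrier_mat k n"
  shows "poly_row_module (T * G) \<subseteq> poly_row_module G"
proof
  fix v assume "v \<in> poly_row_module (T * G)"
  then obtain b where b: "b \<in> carrier_vec m" "v = row_mult b (T * G)"
    using T by (auto simp: poly_row_module_def)
  then have "v = row_mult (row_mult b T) G"
    by (simp add: row_mult_row_mult[OF T G])
  then show "v \<in> poly_row_module G"
    using G row_mult_carrier[OF T, of b] by (auto simp: poly_row_module_def)
qed

section \<open>Row degrees and reduced matrices\<close>

lemma row_degree_ge:
  "j < dim_col G \<Longrightarrow> degree (G $$ (i, j)) \<le> row_degree G i"
  unfolding row_degree_def by (rule Max_ge) auto

lemma row_degree_less:
  assumes "0 < dim_col G" "\<And>j. j < dim_col G \<Longrightarrow> degree (G $$ (i, j)) < d"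
  shows "row_degree G i < d"
proof -
  have "{degree (G $$ (i, j)) | j. j < dim_col G} \<noteq> {}"
    using assms(1) by blast
  then show ?thesis
    using assms(2) by (auto simp: row_degree_def)
qed

text \<open>One \<open>addrow\<close> for each index in \<open>J\<close>. As \<open>i\<close> is not
  in \<open>J\<close>, the rows that are added stay unchanged throughout.\<close>

lemma elem_row_op_add_multiples:
  fixes G :: "'a :: comm_ring_1 mat"
  assumes G: "G \<in> carrier_mat k n" and i: "i < k" and J: "J \<subseteq> {..<k} - {i}"
  shows "elem_row_op\<^sup>*\<^sup>* G (mat k n (\<lambda>(r, j).
    if r = i then G $$ (i, j) + (\<Sum>l\<in>J. c l * G $$ (l, j)) else G $$ (r, j)))"
proof -
  have "finite J"
    by (rule finite_subset[OF J]) simp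
  then show ?thesis
    using J
  proof (induction J)
    case empty
    have "mat k n (\<lambda>(r, j). if r = i then G $$ (i, j) + (\<Sum>l\<in>{}. c l * G $$ (l, j)) else G $$ (r, j)) = G"
      using G by (intro eq_matI) auto
    then show ?case by simp
  next
    case (insert l J)
    let ?M = "\<lambda>J. mat k n (\<lambda>(r, j).
      if r = i then G $$ (i, j) + (\<Sum>l\<in>J. c l * G $$ (l, j)) else G $$ (r, j))"
    have l: "l < k" "l \<noteq> i"
      using insert by auto
    have "elem_row_op\<^sup>*\<^sup>* G (?M J)"
      by (rule insert.IH) (use insert.prems in simp)
    moreover have "addrow (c l) i l (?M J) = ?M (insert l J)"
      using i l insert.hyps by (intro eq_matI) (auto simp: algebra_simps)
    then have "elem_row_op (?M J) (?M (insert l J))"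
      using elem_row_op.add[of i "?M J" l "c l"] i l by simp
    ultimately show ?case
      by (rule rtranclp.rtrancl_into_rtrancl)
  qed
qed

text \<open>In the Cauchy product every term except the one at index \<open>a\<close> exceeds one of
  the degree bounds. The bounds need not be attained, so formal leading coefficients may be
  zero.\<close>

lemma coeff_mult_add:
  assumes "degree p \<le> a" "degree q \<le> b"
  shows "coeff (p * q) (a + b) = coeff p a * coeff q b"
proof -
  have "coeff (p * q) (a + b) = (\<Sum>i\<le>a + b. if i = a then coeff p a * coeff q b else 0)"
    unfolding coeff_mult
  proof (rule sum.cong)
    fix i assume "i \<in> {..a + b}"
    then show "coeff p i * coeff q (a + b - i) = (if i = a then coeff p a * coeff q b else 0)"
      using assms by (cases i a rule: linorder_cases) (auto simp: coeff_eq_0)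
  qed simp
  then show ?thesis by simp
qed

text \<open>The predictable degree property: a vanishing combination of the leading row coefficients
  would allow a row operation that lowers a row degree.\<close>

lemma reduced_matrix_degree:
  fixes G :: "'a :: field poly mat"
  assumes G: "G \<in> carrier_mat k n" and red: "reduced_matrix G" and ind: "indep_rows G"
    and \<alpha>: "\<alpha> \<in> carrier_vec k" and i0: "i0 < k" "\<alpha> $ i0 \<noteq> 0"
  shows "\<exists>j<n. row_degree G i0 \<le> degree (row_mult \<alpha> G $ j)"
proof (rule ccontr)
  assume contra: "\<not> ?thesis"
  let ?d = "row_degree G"
  have dG: "degree (G $$ (i, j)) \<le> ?d i" if "j < n" for i j
    using G row_degree_ge[of j G i] that by simp
  let ?S = "{i. i < k \<and> \<alpha> $ i \<noteq> 0}"
  \<comment> \<open>The degree that the product has unless the leading row coefficients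
    cancel.\<close>
  define D where "D = Max ((\<lambda>i. degree (\<alpha> $ i) + ?d i) ` ?S)"
  have fin: "finite ((\<lambda>i. degree (\<alpha> $ i) + ?d i) ` ?S)" "(\<lambda>i. degree (\<alpha> $ i) + ?d i) ` ?S \<noteq> {}"
    using i0 by auto
  have D_ge: "degree (\<alpha> $ i) + ?d i \<le> D" if "i < k" "\<alpha> $ i \<noteq> 0" for i
    unfolding D_def using fin(1) that by (intro Max_ge) auto
  obtain i1 where i1: "i1 < k" "\<alpha> $ i1 \<noteq> 0" "degree (\<alpha> $ i1) + ?d i1 = D"
    using Max_in[OF fin] unfolding D_def by auto
  \<comment> \<open>\<open>c i\<close> is the coefficient of \<open>\<alpha> $ i\<close> through
    which row \<open>i\<close> of \<open>G\<close> can contribute to the power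
    \<open>D\<close>.\<close>
  define c where "c i = (if ?d i \<le> D then coeff (\<alpha> $ i) (D - ?d i) else 0)" for i
  have "c i1 \<noteq> 0"
    using i1 by (auto simp: c_def)
  \<comment> \<open>By the contradiction hypothesis all entries of the product have degree below
    \<open>?d i0\<close>, hence below \<open>D\<close>, so the coefficient at \<open>D\<close>
    vanishes.\<close>
  have cancel: "(\<Sum>i<k. c i * coeff (G $$ (i, j)) (?d i)) = 0" if j: "j < n" for j
  proof -
    have "degree (row_mult \<alpha> G $ j) < ?d i0"
      using contra j by auto
    also have "?d i0 \<le> D"
      using D_ge[OF i0] by simp
    finally have "coeff (row_mult \<alpha> G $ j) D = 0"
      by (rule coeff_eq_0)
    moreover have "coeff (\<alpha> $ i * G $$ (i, j)) D = c i * coeff (G $$ (i, j)) (?d i)" if "i < k" for i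
    proof (cases "\<alpha> $ i = 0")
      case False
      then have "degree (\<alpha> $ i) \<le> D - ?d i" "?d i \<le> D"
        using D_ge[of i] that by auto
      then show ?thesis
        using coeff_mult_add[of "\<alpha> $ i" "D - ?d i" "G $$ (i, j)" "?d i"] dG[OF j]
        by (simp add: c_def)
    qed (simp add: c_def)
    ultimately show ?thesis
      by (simp add: row_mult_index[OF G \<alpha> j] coeff_sum)
  qed
  let ?L = "{l. l < k \<and> c l \<noteq> 0}"
  have finL: "finite (?d ` ?L)" "?d ` ?L \<noteq> {}"
    using i1(1) \<open>c i1 \<noteq> 0\<close> by auto
  \<comment> \<open>A row of largest degree among those taking part in the relation. All other
    participating rows can then be lifted to degree \<open>?d i\<close> by monomials, while row
    \<open>i\<close> itself keeps the factor 1, so that replacing it is a sequence of elementary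
    operations.\<close>
  obtain i where i: "i < k" "c i \<noteq> 0" "?d i = Max (?d ` ?L)"
    using Max_in[OF finL] by auto
  have d_max: "?d l \<le> ?d i" if "l < k" "c l \<noteq> 0" for l
    unfolding i(3) using finL(1) that by (intro Max_ge) auto
  define q where "q l = monom (c l / c i) (?d i - ?d l)" for l
  define J where "J = {l. l < k \<and> l \<noteq> i \<and> c l \<noteq> 0}"
  have J: "J \<subseteq> {..<k} - {i}" by (auto simp: J_def)
  have q0: "q l = 0" if "c l = 0" for l
    using that by (simp add: q_def)
  have qi: "q i = 1"
    using i by (simp add: q_def)
  define H where "H = mat k n (\<lambda>(r, j).
    if r = i then G $$ (i, j) + (\<Sum>l\<in>J. q l * G $$ (l, j)) else G $$ (r, j))"
  have Hc: "H \<in> carrier_mat k n" by (simp add: H_def)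
  have GH: "row_degree_sum G \<le> row_degree_sum H"
    using red elem_row_op_add_multiples[OF G i(1) J, of q]
    by (simp add: reduced_matrix_def H_def)
  have Hi: "H $$ (i, j) = (\<Sum>l<k. q l * G $$ (l, j))" if j: "j < n" for j
  proof -
    have "(\<Sum>l<k. q l * G $$ (l, j)) = (\<Sum>l\<in>insert i J. q l * G $$ (l, j))"
      using i q0 by (intro sum.mono_neutral_right) (auto simp: J_def)
    also have "\<dots> = q i * G $$ (i, j) + (\<Sum>l\<in>J. q l * G $$ (l, j))"
      by (rule sum.insert) (auto simp: J_def)
    finally show ?thesis
      using i j by (simp add: H_def qi)
  qed
  have qG: "degree (q l * G $$ (l, j)) \<le> ?d i"
    "coeff (q l * G $$ (l, j)) (?d i) = c l / c i * coeff (G $$ (l, j)) (?d l)"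
    if "l < k" "j < n" for l j
  proof -
    have "degree (q l * G $$ (l, j)) \<le> ?d i \<and>
      coeff (q l * G $$ (l, j)) (?d i) = c l / c i * coeff (G $$ (l, j)) (?d l)"
    proof (cases "c l = 0")
      case False
      have dq: "degree (q l) \<le> ?d i - ?d l"
        unfolding q_def by (rule degree_monom_le)
      have "degree (q l * G $$ (l, j)) \<le> degree (q l) + degree (G $$ (l, j))"
        by (rule degree_mult_le)
      also have "\<dots> \<le> (?d i - ?d l) + ?d l"
        using dq dG[OF that(2), of l] by (rule add_mono)
      finally show ?thesis
        using coeff_mult_add[OF dq dG[OF that(2), of l]] d_max[OF that(1) False]
        by (simp add: q_def)
    qed (simp add: q0)
    then show "degree (q l * G $$ (l, j)) \<le> ?d i"
      "coeff (q l * G $$ (l, j)) (?d i) = c l / c i * coeff (G $$ (l, j)) (?d l)" by auto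
  qed
  have deg_le: "degree (H $$ (i, j)) \<le> ?d i" if "j < n" for j
    unfolding Hi[OF that] using qG(1) that by (intro degree_sum_le) auto
  have coeff0: "coeff (H $$ (i, j)) (?d i) = 0" if "j < n" for j
  proof -
    have "coeff (H $$ (i, j)) (?d i) = (\<Sum>l<k. c l * coeff (G $$ (l, j)) (?d l)) / c i"
      using that by (simp add: Hi coeff_sum qG(2) sum_divide_distrib)
    then show ?thesis
      using cancel[OF that] by simp
  qed
  have vq: "vec k q \<in> carrier_vec k" by simp
  have "row_mult (vec k q) G \<noteq> 0\<^sub>v n"
  proof
    assume "row_mult (vec k q) G = 0\<^sub>v n"
    then have "vec k q = 0\<^sub>v k"
      by (rule indep_rowsD[OF ind G vq])
    then have "vec k q $ i = 0\<^sub>v k $ i" by simp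
    then show False
      using i qi by simp
  qed
  moreover have rm: "row_mult (vec k q) G $ j = H $$ (i, j)" if "j < n" for j
    using row_mult_index[OF G vq that] Hi[OF that] by simp
  ultimately obtain j0 where j0: "j0 < n" "H $$ (i, j0) \<noteq> 0"
    using G by (auto simp: vec_eq_iff)
  \<comment> \<open>If \<open>?d i\<close> were 0, the new row would be constant with vanishing
    constant coefficients, although independence keeps it nonzero. Positivity also covers zero
    entries below, whose degree is 0 by convention.\<close>
  have "?d i > 0"
  proof (rule ccontr)
    assume "\<not> ?d i > 0"
    then have "degree (H $$ (i, j0)) = 0" "coeff (H $$ (i, j0)) 0 = 0"
      using deg_le[OF j0(1)] coeff0[OF j0(1)] by auto
    then show False
      using j0(2) by (metis leading_coeff_0_iff)
  qed
  have "degree (H $$ (i, j)) < ?d i" if "j < n" for j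
  proof (rule ccontr)
    assume "\<not> ?thesis"
    then have "degree (H $$ (i, j)) = ?d i"
      using deg_le[OF that] by simp
    then have "H $$ (i, j) = 0"
      using coeff0[OF that] by (metis leading_coeff_0_iff)
    then show False
      using \<open>\<not> degree (H $$ (i, j)) < ?d i\<close> \<open>?d i > 0\<close> by simp
  qed
  then have less: "row_degree H i < ?d i"
    using Hc j0 by (intro row_degree_less) auto
  have same: "row_degree H r = ?d r" if "r < k" "r \<noteq> i" for r
  proof -
    have "H $$ (r, j) = G $$ (r, j)" if "j < n" for j
      using that \<open>r < k\<close> \<open>r \<noteq> i\<close> by (simp add: H_def)
    then have "(\<lambda>j. degree (H $$ (r, j))) ` {..<n} = (\<lambda>j. degree (G $$ (r, j))) ` {..<n}"
      by (intro image_cong) auto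
    then have "{degree (H $$ (r, j)) | j. j < n} = {degree (G $$ (r, j)) | j. j < n}"
      by (simp add: image_def Bex_def conj_commute)
    then show ?thesis
      using G Hc by (simp add: row_degree_def)
  qed
  have "row_degree_sum H < row_degree_sum G"
  proof -
    have "(\<Sum>r<k. row_degree H r) < (\<Sum>r<k. row_degree G r)"
    proof (rule sum_strict_mono_ex1)
      show "\<forall>r\<in>{..<k}. row_degree H r \<le> row_degree G r"
      proof
        fix r assume "r \<in> {..<k}"
        then show "row_degree H r \<le> row_degree G r"
          using less same[of r] by (cases "r = i") auto
      qed
      show "\<exists>r\<in>{..<k}. row_degree H r < row_degree G r"
        using less i(1) by blast
    qed simp
    then show ?thesis
      using G Hc by (simp add: row_degree_sum_def)
  qed
  then show False
    using GH by simp
qed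

text \<open>A nonzero term in the Leibniz expansion of \<open>det T\<close> gives a permutation
  \<open>p\<close> with all \<open>T $$ (i, p i)\<close> nonzero. By the predictable degree
  property, row \<open>i\<close> of \<open>T * G\<close> has at least the degree of row
  \<open>p i\<close> of \<open>G\<close>; summing over \<open>i\<close> gives the claim.\<close>

lemma reduced_row_degree_sum_le:
  fixes G :: "'a :: field poly mat"
  assumes G: "G \<in> carrier_mat k n" and red: "reduced_matrix G" and ind: "indep_rows G"
    and T: "T \<in> carrier_mat k k" and det: "det T \<noteq> 0"
  shows "row_degree_sum G \<le> row_degree_sum (T * G)"
proof -
  have "(\<Sum>p | p permutes {0..<k}. of_int (sign p) * (\<Prod>i = 0..<k. T $$ (i, p i))) \<noteq> 0"
    using det T by (simp add: det_def)
  then obtain p where p: "p permutes {0..<k}" "(\<Prod>i = 0..<k. T $$ (i, p i)) \<noteq> 0"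
    by (rule sum.not_neutral_contains_not_neutral) auto
  have le: "row_degree G (p i) \<le> row_degree (T * G) i" if i: "i < k" for i
  proof -
    have pi: "p i < k"
      using permutes_in_image[OF p(1), of i] i by simp
    have "T $$ (i, p i) \<noteq> 0"
      using p(2) i by simp
    then have "row T i $ p i \<noteq> 0"
      using T i pi by simp
    then obtain j where j: "j < n" "row_degree G (p i) \<le> degree (row_mult (row T i) G $ j)"
      using reduced_matrix_degree[OF G red ind _ pi, of "row T i"] T i by auto
    have "row_mult (row T i) G $ j = (T * G) $$ (i, j)"
      using arg_cong[OF row_row_mult[OF T G i], of "\<lambda>v. v $ j"] T G i j by simp
    then show ?thesis
      using j row_degree_ge[of j "T * G" i] G by auto
  qed
  have "row_degree_sum G = (\<Sum>i = 0..<k. row_degree G i)"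
    using G by (simp add: row_degree_sum_def atLeast0LessThan)
  also have "\<dots> = (\<Sum>i = 0..<k. row_degree G (p i))"
    using sum.permute[OF p(1), of "row_degree G"] by (simp add: o_def)
  also have "\<dots> \<le> (\<Sum>i = 0..<k. row_degree (T * G) i)"
    using le by (intro sum_mono) simp
  also have "\<dots> = row_degree_sum (T * G)"
    using T by (simp add: row_degree_sum_def atLeast0LessThan)
  finally show ?thesis .
qed

lemma canonical_generator_matrix_invariants:
  fixes G H :: "'a :: field poly mat"
  assumes C: "vec_subspace n C"
    and G: "canonical_generator_matrix n k C G" and H: "canonical_generator_matrix n k C H"
  shows "row_degree_sum G = row_degree_sum H" "poly_row_module G = poly_row_module H"
proof -
  \<comment> \<open>One direction for an arbitrary pair of canonical matrices; exchanging their
    roles gives both equalities.\<close>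
  have *: "row_degree_sum G \<le> row_degree_sum H \<and> poly_row_module H \<subseteq> poly_row_module G"
    if "canonical_generator_matrix n k C G" "canonical_generator_matrix n k C H"
    for G H :: "'a poly mat"
  proof -
    have G: "generator_matrix n k C G" "basic_matrix G" "reduced_matrix G"
      and H: "generator_matrix n k C H" "basic_matrix H"
      using that by (auto simp: canonical_generator_matrix_def)
    note G' = generator_matrixD[OF C G(1)]
    obtain T where T: "T \<in> carrier_mat k k" "H = T * G"
      by (rule basic_generator_factor[OF C G(1,2) H(1)])
    obtain T' where T': "T' \<in> carrier_mat k k" "G = T' * H"
      by (rule basic_generator_factor[OF C H(1,2) G(1)])
    have "det T' * det T = 1"
      using det_mult[OF T'(1) T(1)] indep_rows_left_inverse[OF G'(1,4) T T'] by simp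
    then have "det T \<noteq> 0" by auto
    then show ?thesis
      using reduced_row_degree_sum_le[OF G'(1) G(3) G'(4) T(1)] poly_row_module_mult[OF T(1) G'(1)]
      by (simp add: T(2))
  qed
  show "row_degree_sum G = row_degree_sum H" "poly_row_module G = poly_row_module H"
    using *[OF G H] *[OF H G] by auto
qed

section \<open>Weights and windows\<close>

text \<open>Flat indices of block vectors are split into the block number \<open>m div k\<close> and
  the position \<open>m mod k\<close> inside the block.\<close>

lemma sum_div_mod:
  fixes f :: "nat \<Rightarrow> nat \<Rightarrow> 'b :: comm_monoid_add"
  shows "(\<Sum>m<k * l. f (m div k) (m mod k)) = (\<Sum>r<l. \<Sum>i<k. f r i)"
proof -
  have "(\<Sum>m<k * l. f (m div k) (m mod k)) = (\<Sum>r<l. \<Sum>m = r * k..<r * k + k. f (m div k) (m mod k))"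
    using sum.nat_group[of "\<lambda>m. f (m div k) (m mod k)" k l] by (simp add: mult.commute)
  also have "\<dots> = (\<Sum>r<l. \<Sum>i<k. f r i)"
    by (rule sum.cong[OF refl])
      (auto simp: sum.atLeastLessThan_shift_0 atLeast0LessThan intro!: sum.cong[OF refl])
  finally show ?thesis .
qed

text \<open>The transpose is padded with zero rows to a square matrix. Row \<open>n\<close> is one
  of them because \<open>n < m\<close>, so the determinant vanishes.\<close>

lemma nontrivial_left_kernel:
  fixes A :: "'a :: field mat"
  assumes A: "A \<in> carrier_mat m n" and "n < m"
  obtains x where "x \<in> carrier_vec m" "x \<noteq> 0\<^sub>v m" "row_mult x A = 0\<^sub>v n"
proof -
  define M where "M = mat\<^sub>r m m (\<lambda>i. if i = n then 0\<^sub>v m else vec m (\<lambda>j. if i < n then A $$ (j, i) else 0))"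
  have M: "M \<in> carrier_mat m m" by (simp add: M_def)
  have "det M = 0"
    unfolding M_def by (rule det_row_0[OF \<open>n < m\<close>]) auto
  then obtain x where x: "x \<in> carrier_vec m" "x \<noteq> 0\<^sub>v m" "M *\<^sub>v x = 0\<^sub>v m"
    using det_0_iff_vec_prod_zero_field[OF M] by blast
  have "row_mult x A = 0\<^sub>v n"
  proof (rule eq_vecI)
    fix j assume "j < dim_vec (0\<^sub>v n :: 'a vec)"
    then have j: "j < n" by simp
    have "(M *\<^sub>v x) $ j = (\<Sum>i<m. x $ i * A $$ (i, j))"
      using x(1) j \<open>n < m\<close>
      by (auto simp: M_def scalar_prod_def atLeast0LessThan mult.commute intro!: sum.cong)
    then have "(\<Sum>i<m. x $ i * A $$ (i, j)) = 0"
      using x(3) j \<open>n < m\<close> by simp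
    then show "row_mult x A $ j = 0\<^sub>v n $ j"
      using row_mult_index[OF A x(1) j] j by simp
  qed (use A in simp)
  then show thesis
    using that x by blast
qed

section \<open>Hamming weight, minimum distance and polynomial weight\<close>

definition hamming_weight :: "'a :: zero vec \<Rightarrow> nat"
  where "hamming_weight v = (\<Sum>i<dim_vec v. of_bool (v $ i \<noteq> 0))"

lemma hamming_distance_eq_weight:
  fixes u v :: "'a :: group_add vec"
  assumes "u \<in> carrier_vec n" "v \<in> carrier_vec n"
  shows "hamming_distance u v = hamming_weight (u - v)"
proof -
  have "hamming_weight (u - v) = (\<Sum>i<n. of_bool (u $ i \<noteq> v $ i))"
    unfolding hamming_weight_def using assms by (intro sum.cong) auto
  also have "\<dots> = card ({..<n} \<inter> {i. u $ i \<noteq> v $ i})"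
    by simp
  also have "{..<n} \<inter> {i. u $ i \<noteq> v $ i} = {i. i < dim_vec u \<and> u $ i \<noteq> v $ i}"
    using assms by auto
  finally show ?thesis
    by (simp add: hamming_distance_def)
qed

lemma min_distance_le:
  fixes v :: "'a :: group_add vec"
  assumes "v \<in> B" "0\<^sub>v n \<in> B" "v \<in> carrier_vec n" "v \<noteq> 0\<^sub>v n"
  shows "min_distance B \<le> hamming_weight v"
proof -
  have "v - 0\<^sub>v n = v"
    using assms(3) by (intro eq_vecI) auto
  then have "hamming_weight v = hamming_distance v (0\<^sub>v n)"
    using hamming_distance_eq_weight[of v n "0\<^sub>v n"] assms(3) by simp
  then show ?thesis
    unfolding min_distance_def using assms by (intro Least_le) blast
qed

text \<open>Closure under differences turns a closest pair of words into a word of minimal weight.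
  The nonzero word \<open>w\<close> guarantees that there are two different words, so that the
  \<open>LEAST\<close> in \<open>min_distance\<close> is attained.\<close>

lemma min_distance_attained:
  fixes B :: "'a :: group_add vec set"
  assumes B: "B \<subseteq> carrier_vec n" and diff: "\<And>u v. u \<in> B \<Longrightarrow> v \<in> B \<Longrightarrow> u - v \<in> B"
    and w: "w \<in> B" "w \<noteq> 0\<^sub>v n"
  obtains v where "v \<in> B" "v \<noteq> 0\<^sub>v n" "hamming_weight v = min_distance B"
proof -
  have "w - w = 0\<^sub>v n"
    using w(1) B by (intro eq_vecI) auto
  then have "0\<^sub>v n \<in> B"
    using diff[OF w(1) w(1)] by simp
  then have "\<exists>d. \<exists>u\<in>B. \<exists>v\<in>B. u \<noteq> v \<and> d = hamming_distance u v"
    using w by blast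
  then have "\<exists>u\<in>B. \<exists>v\<in>B. u \<noteq> v \<and> min_distance B = hamming_distance u v"
    unfolding min_distance_def by (rule LeastI_ex)
  then obtain u v where uv: "u \<in> B" "v \<in> B" "u \<noteq> v" "min_distance B = hamming_distance u v"
    by blast
  have carr: "u \<in> carrier_vec n" "v \<in> carrier_vec n"
    using uv B by auto
  have "u - v \<noteq> 0\<^sub>v n"
  proof
    assume 0: "u - v = 0\<^sub>v n"
    have "u = v"
    proof (rule eq_vecI)
      fix i assume "i < dim_vec v"
      then show "u $ i = v $ i"
        using carr arg_cong[OF 0, of "\<lambda>w. w $ i"] by simp
    qed (use carr in auto)
    then show False
      using uv by simp
  qed
  then show thesis
    using that[of "u - v"] diff[OF uv(1,2)] uv(4) hamming_distance_eq_weight[OF carr] by simp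
qed

lemma card_coeff_neq_0:
  assumes "degree p < N"
  shows "card {i. coeff p i \<noteq> 0} = (\<Sum>s<N. of_bool (coeff p s \<noteq> 0))"
proof -
  have "{i. coeff p i \<noteq> 0} = {..<N} \<inter> {i. coeff p i \<noteq> 0}"
    using assms le_degree le_less_trans by blast
  then show ?thesis by simp
qed

text \<open>Nonzero coefficients are counted power by power instead of entry by entry.\<close>

lemma poly_weight_eq:
  assumes "\<And>j. j < dim_vec v \<Longrightarrow> degree (v $ j) < N"
  shows "poly_weight v = (\<Sum>s<N. hamming_weight (map_vec (\<lambda>p. coeff p s) v))"
proof -
  have "poly_weight v = (\<Sum>j<dim_vec v. \<Sum>s<N. of_bool (coeff (v $ j) s \<noteq> 0))"
    unfolding poly_weight_def using assms by (intro sum.cong card_coeff_neq_0) auto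
  also have "\<dots> = (\<Sum>s<N. \<Sum>j<dim_vec v. of_bool (coeff (v $ j) s \<noteq> 0))"
    by (rule sum.swap)
  also have "\<dots> = (\<Sum>s<N. hamming_weight (map_vec (\<lambda>p. coeff p s) v))"
    unfolding hamming_weight_def by (intro sum.cong refl) auto
  finally show ?thesis .
qed

text \<open>Dropping the \<open>s\<close> lowest coefficients only loses nonzero ones:
  \<open>i \<mapsto> i + s\<close> injects the remaining ones into the old ones.\<close>

lemma poly_weight_shift_le: "poly_weight (map_vec (poly_shift s) v) \<le> poly_weight v"
proof -
  have "card {i. coeff (poly_shift s p) i \<noteq> 0} \<le> card {i. coeff p i \<noteq> 0}" for p :: "'a poly"
  proof (rule card_inj_on_le[of "\<lambda>i. i + s"])
    show "finite {i. coeff p i \<noteq> 0}"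
      using MOST_coeff_eq_0[of p] by (simp add: eventually_cofinite)
  qed (auto simp: coeff_poly_shift)
  then show ?thesis
    by (auto simp: poly_weight_def intro!: sum_mono)
qed

section \<open>Windows of a message\<close>

context
  fixes G :: "'a :: field poly mat" and k n \<delta> :: nat
  assumes G: "G \<in> carrier_mat k n"
    and deg: "\<And>i j. i < k \<Longrightarrow> j < n \<Longrightarrow> degree (G $$ (i, j)) \<le> \<delta>"
begin

lemma stacked_carrier: "stacked_matrix G \<delta> \<in> carrier_mat (k * (\<delta> + 1)) n"
  using G by (simp add: stacked_matrix_def Let_def)

lemma sliding_carrier: "sliding_matrix G \<delta> l \<in> carrier_mat (k * (l + 1)) (n * (\<delta> + l + 1))"
  using G by (simp add: sliding_matrix_def Let_def)

lemma coeff_row_mult: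
  assumes \<alpha>: "\<alpha> \<in> carrier_vec k" and j: "j < n"
  shows "coeff (row_mult \<alpha> G $ j) s =
    (\<Sum>i<k. \<Sum>t\<le>s. coeff (\<alpha> $ i) t * coeff (G $$ (i, j)) (s - t))"
  by (simp add: row_mult_index[OF G \<alpha> j] coeff_sum coeff_mult)

lemma degree_row_mult:
  assumes \<alpha>: "\<alpha> \<in> carrier_vec k" and j: "j < n" and l: "\<And>i. i < k \<Longrightarrow> degree (\<alpha> $ i) \<le> l"
  shows "degree (row_mult \<alpha> G $ j) \<le> l + \<delta>"
proof -
  have "degree (\<alpha> $ i * G $$ (i, j)) \<le> l + \<delta>" if "i < k" for i
    using degree_mult_le[of "\<alpha> $ i" "G $$ (i, j)"] l[OF that] deg[OF that j] by linarith
  then show ?thesis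
    unfolding row_mult_index[OF G \<alpha> j] by (intro degree_sum_le) auto
qed

text \<open>Block \<open>b\<close> holds the coefficients at the power s - \<delta> + b, with zeros
  for negative powers. It meets block \<open>b\<close> of the stacked matrix, the coefficient matrix
  at \<delta> - b, so that the powers add up to \<open>s\<close>.\<close>

definition window :: "'a poly vec \<Rightarrow> nat \<Rightarrow> 'a vec" where
  "window \<alpha> s = vec (k * (\<delta> + 1))
    (\<lambda>m. if \<delta> \<le> s + m div k then coeff (\<alpha> $ (m mod k)) (s + m div k - \<delta>) else 0)"

lemma coeff_row_mult_window:
  assumes \<alpha>: "\<alpha> \<in> carrier_vec k"
  shows "map_vec (\<lambda>p. coeff p s) (row_mult \<alpha> G) = row_mult (window \<alpha> s) (stacked_matrix G \<delta>)"
proof (rule eq_vecI)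
  fix j assume "j < dim_vec (row_mult (window \<alpha> s) (stacked_matrix G \<delta>))"
  then have j: "j < n"
    using stacked_carrier by simp
  have w: "window \<alpha> s \<in> carrier_vec (k * (\<delta> + 1))"
    by (simp add: window_def)
  define f where "f b i = (if \<delta> \<le> s + b then coeff (\<alpha> $ i) (s + b - \<delta>) else 0)
    * coeff (G $$ (i, j)) (\<delta> - b)" for b i
  have "row_mult (window \<alpha> s) (stacked_matrix G \<delta>) $ j =
      (\<Sum>m<k * (\<delta> + 1). window \<alpha> s $ m * stacked_matrix G \<delta> $$ (m, j))"
    by (rule row_mult_index[OF stacked_carrier w j])
  also have "\<dots> = (\<Sum>m<k * (\<delta> + 1). f (m div k) (m mod k))"
  proof (rule sum.cong)
    fix m assume "m \<in> {..<k * (\<delta> + 1)}"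
    then have m: "m < k * (\<delta> + 1)" by simp
    then have "m mod k < k"
      by (cases "k = 0") auto
    then show "window \<alpha> s $ m * stacked_matrix G \<delta> $$ (m, j) = f (m div k) (m mod k)"
      using m j G by (simp add: window_def stacked_matrix_def coeff_mat_def f_def Let_def)
  qed simp
  also have "\<dots> = (\<Sum>b<\<delta> + 1. \<Sum>i<k. f b i)"
    by (rule sum_div_mod)
  also have "\<dots> = (\<Sum>i<k. \<Sum>b<\<delta> + 1. f b i)"
    by (rule sum.swap)
  also have "\<dots> = (\<Sum>i<k. \<Sum>t\<le>s. coeff (\<alpha> $ i) t * coeff (G $$ (i, j)) (s - t))"
  proof (rule sum.cong)
    fix i assume "i \<in> {..<k}"
    then have i: "i < k" by simp
    have "(\<Sum>b<\<delta> + 1. f b i) = (\<Sum>b\<in>{b. b \<le> \<delta> \<and> \<delta> \<le> s + b}. f b i)"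
      by (rule sum.mono_neutral_right) (auto simp: f_def)
    \<comment> \<open>Substitution t = s + b - \<delta>; the side condition keeps the natural
      subtraction exact.\<close>
    also have "\<dots> = (\<Sum>t\<in>{t. t \<le> s \<and> s \<le> t + \<delta>}. coeff (\<alpha> $ i) t * coeff (G $$ (i, j)) (s - t))"
      by (rule sum.reindex_bij_witness[of _ "\<lambda>t. t + \<delta> - s" "\<lambda>b. s + b - \<delta>"]) (auto simp: f_def)
    \<comment> \<open>The terms added here have s - t > \<delta> and vanish by the degree bound on
      \<open>G\<close>.\<close>
    also have "\<dots> = (\<Sum>t\<le>s. coeff (\<alpha> $ i) t * coeff (G $$ (i, j)) (s - t))"
    proof (rule sum.mono_neutral_left)
      show "\<forall>t\<in>{..s} - {t. t \<le> s \<and> s \<le> t + \<delta>}. coeff (\<alpha> $ i) t * coeff (G $$ (i, j)) (s - t) = 0"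
        using deg[OF i j] by (auto intro!: coeff_eq_0)
    qed auto
    finally show "(\<Sum>b<\<delta> + 1. f b i) = (\<Sum>t\<le>s. coeff (\<alpha> $ i) t * coeff (G $$ (i, j)) (s - t))" .
  qed simp
  also have "\<dots> = coeff (row_mult \<alpha> G $ j) s"
    by (rule coeff_row_mult[OF \<alpha> j, symmetric])
  finally show "map_vec (\<lambda>p. coeff p s) (row_mult \<alpha> G) $ j =
      row_mult (window \<alpha> s) (stacked_matrix G \<delta>) $ j"
    using j G by simp
qed (use G stacked_carrier in simp)

text \<open>The coefficient of \<open>\<alpha> $ i\<close> at \<open>t\<close> sits in block t +
  \<delta> - s of the window.\<close>

lemma window_eq_0D:
  assumes 0: "window \<alpha> s = 0\<^sub>v (k * (\<delta> + 1))" and i: "i < k" and t: "t \<le> s" "s \<le> t + \<delta>"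
  shows "coeff (\<alpha> $ i) t = 0"
proof -
  let ?b = "t + \<delta> - s"
  have b: "?b \<le> \<delta>"
    using t by simp
  have "?b * k + i < ?b * k + k"
    using i by simp
  also have "\<dots> \<le> k * (\<delta> + 1)"
    using mult_le_mono1[OF b, of k] by (simp add: algebra_simps)
  finally have m: "?b * k + i < k * (\<delta> + 1)" .
  have "window \<alpha> s $ (?b * k + i) = 0"
    using m by (simp only: 0 index_zero_vec)
  moreover have "window \<alpha> s $ (?b * k + i) = coeff (\<alpha> $ i) t"
    using m i t by (simp add: window_def)
  ultimately show ?thesis by simp
qed

text \<open>A vanishing window decouples the message behind it from the message before it. In the
  coefficient at r + s + 1, a term with t \<le> s vanishes: either \<open>t\<close> lies in the
  window, or r + s + 1 - t exceeds \<delta>. Hence encoding the tail gives the tail of the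
  codeword.\<close>

lemma row_mult_shift:
  assumes \<alpha>: "\<alpha> \<in> carrier_vec k" and 0: "window \<alpha> s = 0\<^sub>v (k * (\<delta> + 1))"
  shows "row_mult (map_vec (poly_shift (Suc s)) \<alpha>) G = map_vec (poly_shift (Suc s)) (row_mult \<alpha> G)"
proof (rule eq_vecI)
  fix j assume "j < dim_vec (map_vec (poly_shift (Suc s)) (row_mult \<alpha> G))"
  then have j: "j < n"
    using G by simp
  have \<alpha>': "map_vec (poly_shift (Suc s)) \<alpha> \<in> carrier_vec k"
    using \<alpha> by simp
  have "coeff (row_mult (map_vec (poly_shift (Suc s)) \<alpha>) G $ j) r =
      coeff (row_mult \<alpha> G $ j) (r + Suc s)" for r
  proof -
    have "(\<Sum>t\<le>r. coeff (map_vec (poly_shift (Suc s)) \<alpha> $ i) t * coeff (G $$ (i, j)) (r - t)) =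
        (\<Sum>t\<le>r + Suc s. coeff (\<alpha> $ i) t * coeff (G $$ (i, j)) (r + Suc s - t))" if i: "i < k" for i
    proof -
      have "(\<Sum>t\<le>r + Suc s. coeff (\<alpha> $ i) t * coeff (G $$ (i, j)) (r + Suc s - t)) =
          (\<Sum>t\<in>{Suc s..r + Suc s}. coeff (\<alpha> $ i) t * coeff (G $$ (i, j)) (r + Suc s - t))"
      proof (rule sum.mono_neutral_right)
        show "\<forall>t\<in>{..r + Suc s} - {Suc s..r + Suc s}.
            coeff (\<alpha> $ i) t * coeff (G $$ (i, j)) (r + Suc s - t) = 0"
        proof
          fix t assume "t \<in> {..r + Suc s} - {Suc s..r + Suc s}"
          then have t: "t \<le> s" by auto
          show "coeff (\<alpha> $ i) t * coeff (G $$ (i, j)) (r + Suc s - t) = 0"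
          proof (cases "s \<le> t + \<delta>")
            case True
            then show ?thesis
              using window_eq_0D[OF 0 i t] by simp
          next
            case False
            then show ?thesis
              using deg[OF i j] by (simp add: coeff_eq_0)
          qed
        qed
      qed auto
      also have "\<dots> = (\<Sum>t\<le>r. coeff (\<alpha> $ i) (t + Suc s) * coeff (G $$ (i, j)) (r - t))"
        by (rule sum.reindex_bij_witness[of _ "\<lambda>t. t + Suc s" "\<lambda>t. t - Suc s"]) auto
      finally show ?thesis
        using i \<alpha> by (simp add: coeff_poly_shift)
    qed
    then show ?thesis
      unfolding coeff_row_mult[OF \<alpha> j] coeff_row_mult[OF \<alpha>' j]
      by (intro sum.cong[OF refl]) (simp only: lessThan_iff)
  qed
  then show "row_mult (map_vec (poly_shift (Suc s)) \<alpha>) G $ j =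
      map_vec (poly_shift (Suc s)) (row_mult \<alpha> G) $ j"
    using j G by (intro poly_eqI) (simp add: coeff_poly_shift)
qed simp

section \<open>Polynomial messages and the sliding block code\<close>

text \<open>Block \<open>r\<close> collects the coefficients at the power \<open>r\<close>, matching
  block row \<open>r\<close> of the sliding matrix.\<close>

definition block_message :: "nat \<Rightarrow> 'a poly vec \<Rightarrow> 'a vec" where
  "block_message l \<alpha> = vec (k * (l + 1)) (\<lambda>m. coeff (\<alpha> $ (m mod k)) (m div k))"

lemma block_message_carrier: "block_message l \<alpha> \<in> carrier_vec (k * (l + 1))"
  by (simp add: block_message_def)

lemma sliding_row_mult:
  assumes \<alpha>: "\<alpha> \<in> carrier_vec k" and l: "\<And>i. i < k \<Longrightarrow> degree (\<alpha> $ i) \<le> l"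
    and p: "p < n * (\<delta> + l + 1)"
  shows "row_mult (block_message l \<alpha>) (sliding_matrix G \<delta> l) $ p =
    coeff (row_mult \<alpha> G $ (p mod n)) (p div n)"
proof -
  let ?c = "p div n" and ?j = "p mod n"
  have j: "?j < n"
    using p by (cases "n = 0") auto
  define f where "f r i = coeff (\<alpha> $ i) r *
    (if r \<le> ?c \<and> ?c \<le> r + \<delta> then coeff (G $$ (i, ?j)) (?c - r) else 0)" for r i
  have "row_mult (block_message l \<alpha>) (sliding_matrix G \<delta> l) $ p =
      (\<Sum>m<k * (l + 1). block_message l \<alpha> $ m * sliding_matrix G \<delta> l $$ (m, p))"
    by (rule row_mult_index[OF sliding_carrier block_message_carrier p])
  also have "\<dots> = (\<Sum>m<k * (l + 1). f (m div k) (m mod k))"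
  proof (rule sum.cong)
    fix m assume "m \<in> {..<k * (l + 1)}"
    then have m: "m < k * (l + 1)" by simp
    then have "m mod k < k"
      by (cases "k = 0") auto
    then show "block_message l \<alpha> $ m * sliding_matrix G \<delta> l $$ (m, p) = f (m div k) (m mod k)"
      using m j p G by (simp add: block_message_def sliding_matrix_def coeff_mat_def f_def Let_def)
  qed simp
  also have "\<dots> = (\<Sum>r<l + 1. \<Sum>i<k. f r i)"
    by (rule sum_div_mod)
  also have "\<dots> = (\<Sum>i<k. \<Sum>r<l + 1. f r i)"
    by (rule sum.swap)
  also have "\<dots> = (\<Sum>i<k. \<Sum>t\<le>?c. coeff (\<alpha> $ i) t * coeff (G $$ (i, ?j)) (?c - t))"
  proof (rule sum.cong)
    fix i assume "i \<in> {..<k}"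
    then have i: "i < k" by simp
    \<comment> \<open>The range is first cut to \<open>r \<le> ?c\<close> by the support of the
      sliding matrix, and then extended beyond \<open>l\<close>, where the coefficients of the
      message are zero.\<close>
    have "(\<Sum>r<l + 1. f r i) = (\<Sum>r\<in>{r. r \<le> ?c \<and> r \<le> l}. f r i)"
      by (rule sum.mono_neutral_right) (auto simp: f_def)
    also have "\<dots> = (\<Sum>t\<le>?c. f t i)"
    proof (rule sum.mono_neutral_left)
      show "\<forall>t\<in>{..?c} - {r. r \<le> ?c \<and> r \<le> l}. f t i = 0"
      proof
        fix t assume "t \<in> {..?c} - {r. r \<le> ?c \<and> r \<le> l}"
        then have "coeff (\<alpha> $ i) t = 0"
          using l[OF i] by (intro coeff_eq_0) auto
        then show "f t i = 0"
          by (simp add: f_def)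
      qed
    qed auto
    also have "\<dots> = (\<Sum>t\<le>?c. coeff (\<alpha> $ i) t * coeff (G $$ (i, ?j)) (?c - t))"
    proof (rule sum.cong)
      fix t assume "t \<in> {..?c}"
      then show "f t i = coeff (\<alpha> $ i) t * coeff (G $$ (i, ?j)) (?c - t)"
        using deg[OF i j] by (auto simp: f_def coeff_eq_0)
    qed simp
    finally show "(\<Sum>r<l + 1. f r i) = (\<Sum>t\<le>?c. coeff (\<alpha> $ i) t * coeff (G $$ (i, ?j)) (?c - t))" .
  qed simp
  also have "\<dots> = coeff (row_mult \<alpha> G $ ?j) ?c"
    by (rule coeff_row_mult[OF \<alpha> j, symmetric])
  finally show ?thesis .
qed

text \<open>The product has degree at most l + \<delta>, so the \<delta> + l + 1 blocks list all of
  its coefficients.\<close>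

lemma hamming_weight_sliding:
  assumes \<alpha>: "\<alpha> \<in> carrier_vec k" and l: "\<And>i. i < k \<Longrightarrow> degree (\<alpha> $ i) \<le> l"
  shows "hamming_weight (row_mult (block_message l \<alpha>) (sliding_matrix G \<delta> l)) =
    poly_weight (row_mult \<alpha> G)"
proof -
  let ?v = "row_mult \<alpha> G" and ?N = "\<delta> + l + 1"
  have "hamming_weight (row_mult (block_message l \<alpha>) (sliding_matrix G \<delta> l)) =
      (\<Sum>p<n * ?N. of_bool (coeff (?v $ (p mod n)) (p div n) \<noteq> 0))"
    unfolding hamming_weight_def using sliding_carrier[of l] sliding_row_mult[OF \<alpha> l]
    by (intro sum.cong) auto
  also have "\<dots> = (\<Sum>s<?N. \<Sum>j<n. of_bool (coeff (?v $ j) s \<noteq> 0))"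
    by (rule sum_div_mod)
  also have "\<dots> = (\<Sum>s<?N. hamming_weight (map_vec (\<lambda>p. coeff p s) ?v))"
    unfolding hamming_weight_def using G by (intro sum.cong) auto
  also have "\<dots> = poly_weight ?v"
    using degree_row_mult[OF \<alpha> _ l] G
    by (intro poly_weight_eq[symmetric]) (auto simp: less_Suc_eq_le add.commute)
  finally show ?thesis .
qed

lemma sliding_row_mult_eq_0_iff:
  assumes \<alpha>: "\<alpha> \<in> carrier_vec k" and l: "\<And>i. i < k \<Longrightarrow> degree (\<alpha> $ i) \<le> l"
  shows "row_mult (block_message l \<alpha>) (sliding_matrix G \<delta> l) = 0\<^sub>v (n * (\<delta> + l + 1)) \<longleftrightarrow>
    row_mult \<alpha> G = 0\<^sub>v n"
proof
  assume 0: "row_mult \<alpha> G = 0\<^sub>v n"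
  show "row_mult (block_message l \<alpha>) (sliding_matrix G \<delta> l) = 0\<^sub>v (n * (\<delta> + l + 1))"
  proof (rule eq_vecI)
    fix p assume "p < dim_vec (0\<^sub>v (n * (\<delta> + l + 1)) :: 'a vec)"
    then have p: "p < n * (\<delta> + l + 1)" by simp
    then have "p mod n < n"
      by (cases "n = 0") auto
    then show "row_mult (block_message l \<alpha>) (sliding_matrix G \<delta> l) $ p = 0\<^sub>v (n * (\<delta> + l + 1)) $ p"
      using sliding_row_mult[OF \<alpha> l p] p by (simp add: 0)
  qed (use sliding_carrier[of l] in simp)
next
  assume 0: "row_mult (block_message l \<alpha>) (sliding_matrix G \<delta> l) = 0\<^sub>v (n * (\<delta> + l + 1))"
  show "row_mult \<alpha> G = 0\<^sub>v n"
  proof (rule eq_vecI)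
    fix j assume "j < dim_vec (0\<^sub>v n :: 'a poly vec)"
    then have j: "j < n" by simp
    have "coeff (row_mult \<alpha> G $ j) s = 0" for s
    proof (cases "s \<le> \<delta> + l")
      case True
      have "s * n + j < s * n + n"
        using j by simp
      also have "\<dots> \<le> n * (\<delta> + l + 1)"
        using mult_le_mono1[OF True, of n] by (simp add: algebra_simps)
      finally have p: "s * n + j < n * (\<delta> + l + 1)" .
      have "coeff (row_mult \<alpha> G $ ((s * n + j) mod n)) ((s * n + j) div n) = 0"
        using p by (simp only: sliding_row_mult[OF \<alpha> l p, symmetric] 0 index_zero_vec)
      then show ?thesis
        using j by simp
    next
      case False
      then show ?thesis
        using degree_row_mult[OF \<alpha> j l] by (intro coeff_eq_0) auto
    qed
    then show "row_mult \<alpha> G $ j = 0\<^sub>v n $ j"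
      using j by (intro poly_eqI) simp
  qed (use G in simp)
qed

text \<open>With this, every word of the sliding block code comes from a polynomial message of
  degree at most \<open>l\<close>.\<close>

lemma block_message_surj:
  assumes a: "a \<in> carrier_vec (k * (l + 1))"
  obtains \<alpha> where "\<alpha> \<in> carrier_vec k" "\<And>i. i < k \<Longrightarrow> degree (\<alpha> $ i) \<le> l" "block_message l \<alpha> = a"
proof
  let ?\<alpha> = "vec k (\<lambda>i. \<Sum>r<l + 1. monom (a $ (r * k + i)) r)"
  show "?\<alpha> \<in> carrier_vec k" by simp
  show "degree (?\<alpha> $ i) \<le> l" if "i < k" for i
  proof -
    have "degree (\<Sum>r<l + 1. monom (a $ (r * k + i)) r) \<le> l"
      by (rule degree_sum_le) (auto intro: order.trans[OF degree_monom_le])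
    then show ?thesis
      using that by simp
  qed
  show "block_message l ?\<alpha> = a"
  proof (rule eq_vecI)
    fix m assume "m < dim_vec a"
    then have m: "m < k * (l + 1)"
      using a by simp
    then have "m mod k < k"
      by (cases "k = 0") auto
    moreover have "m div k < l + 1"
      using m by (simp add: less_mult_imp_div_less mult.commute)
    ultimately show "block_message l ?\<alpha> $ m = a $ m"
      using m by (simp add: block_message_def coeff_sum)
  qed (use a in \<open>simp add: block_message_def\<close>)
qed

section \<open>The code of the stacked matrix and minimal words\<close>

lemma stacked_code_eq:
  "stacked_code G \<delta> = (\<lambda>\<alpha>. row_mult \<alpha> (stacked_matrix G \<delta>)) ` carrier_vec (k * (\<delta> + 1))"
  using G by (simp add: stacked_code_def)

text \<open>Independence of the stacked rows makes the image of a nonzero window a nonzero word, to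
  which the minimum distance applies.\<close>

lemma min_distance_stacked_le:
  assumes ind: "indep_rows (stacked_matrix G \<delta>)"
    and w: "w \<in> carrier_vec (k * (\<delta> + 1))" "w \<noteq> 0\<^sub>v (k * (\<delta> + 1))"
  shows "min_distance (stacked_code G \<delta>) \<le> hamming_weight (row_mult w (stacked_matrix G \<delta>))"
proof (rule min_distance_le)
  show "row_mult w (stacked_matrix G \<delta>) \<in> stacked_code G \<delta>"
    using w by (simp add: stacked_code_eq)
  have "row_mult (0\<^sub>v (k * (\<delta> + 1))) (stacked_matrix G \<delta>) = 0\<^sub>v n"
    by (rule row_mult_zero[OF stacked_carrier])
  then show "0\<^sub>v n \<in> stacked_code G \<delta>"
    unfolding stacked_code_eq by (metis image_eqI zero_carrier_vec)
  show "row_mult w (stacked_matrix G \<delta>) \<in> carrier_vec n"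
    by (rule row_mult_carrier[OF stacked_carrier])
  show "row_mult w (stacked_matrix G \<delta>) \<noteq> 0\<^sub>v n"
    using indep_rowsD[OF ind stacked_carrier w(1)] w(2) by blast
qed

lemma hamming_weight_pos:
  assumes "v \<in> carrier_vec m" "v \<noteq> 0\<^sub>v m"
  shows "0 < hamming_weight v"
proof -
  obtain i where i: "i < m" "v $ i \<noteq> 0"
    using assms by (auto simp: vec_eq_iff)
  have "0 < (\<Sum>i<m. of_bool (v $ i \<noteq> 0) :: nat)"
    by (rule sum_pos2[of _ i]) (use i in auto)
  then show ?thesis
    using assms(1) by (simp only: hamming_weight_def carrier_vecD)
qed

text \<open>Positivity of \<mu> is what permits the division by \<mu>; \<open>0 < k\<close> ensures
  that the code has a nonzero word.\<close>

lemma min_distance_stacked_pos: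
  assumes k: "0 < k" and ind: "indep_rows (stacked_matrix G \<delta>)"
  shows "0 < min_distance (stacked_code G \<delta>)"
proof -
  let ?S = "stacked_matrix G \<delta>" and ?u = "unit_vec (k * (\<delta> + 1)) 0 :: 'a vec"
  have diff: "u - v \<in> stacked_code G \<delta>"
    if uv: "u \<in> stacked_code G \<delta>" "v \<in> stacked_code G \<delta>" for u v
  proof -
    obtain a b where ab: "a \<in> carrier_vec (k * (\<delta> + 1))" "b \<in> carrier_vec (k * (\<delta> + 1))"
      "u = row_mult a ?S" "v = row_mult b ?S"
      using uv unfolding stacked_code_eq by blast
    then show ?thesis
      unfolding stacked_code_eq using row_mult_diff[OF stacked_carrier ab(1,2)]
      by (intro image_eqI[of _ _ "a - b"]) auto
  qed
  have "?u $ 0 \<noteq> 0\<^sub>v (k * (\<delta> + 1)) $ 0"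
    using k by simp
  then have "?u \<noteq> 0\<^sub>v (k * (\<delta> + 1))" by metis
  then have "row_mult ?u ?S \<noteq> 0\<^sub>v n"
    using indep_rowsD[OF ind stacked_carrier, of ?u] by auto
  moreover have "row_mult ?u ?S \<in> stacked_code G \<delta>"
    by (simp add: stacked_code_eq)
  moreover have sub: "stacked_code G \<delta> \<subseteq> carrier_vec n"
    using row_mult_carrier[OF stacked_carrier] by (auto simp: stacked_code_eq)
  ultimately obtain v where "v \<in> stacked_code G \<delta>" "v \<noteq> 0\<^sub>v n"
    "hamming_weight v = min_distance (stacked_code G \<delta>)"
    using min_distance_attained[OF sub diff] by blast
  then show ?thesis
    using hamming_weight_pos[of v n] sub by auto
qed

text \<open>The first \<open>k\<close> rows of the stacked matrix hold the coefficients at \<delta>.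
  A row of \<open>G\<close> of smaller degree would leave a zero row there.\<close>

lemma stacked_indep_degree:
  assumes ind: "indep_rows (stacked_matrix G \<delta>)" and r: "r < k"
  shows "\<exists>j<n. degree (G $$ (r, j)) = \<delta>"
proof (rule ccontr)
  assume contra: "\<not> ?thesis"
  let ?S = "stacked_matrix G \<delta>" and ?u = "unit_vec (k * (\<delta> + 1)) r :: 'a vec"
  have r': "r < k * (\<delta> + 1)"
    using r by (simp add: trans_less_add1)
  have u: "?u \<in> carrier_vec (k * (\<delta> + 1))" by simp
  have "row_mult ?u ?S = 0\<^sub>v n"
  proof (rule eq_vecI)
    fix j assume "j < dim_vec (0\<^sub>v n :: 'a vec)"
    then have j: "j < n" by simp
    have "degree (G $$ (r, j)) < \<delta>"
      using contra deg[OF r j] j by force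
    then have "coeff (G $$ (r, j)) \<delta> = 0"
      by (rule coeff_eq_0)
    then have S: "?S $$ (r, j) = 0"
      using r r' j G by (simp add: stacked_matrix_def coeff_mat_def Let_def)
    have "row_mult ?u ?S $ j = (\<Sum>m<k * (\<delta> + 1). ?u $ m * ?S $$ (m, j))"
      by (rule row_mult_index[OF stacked_carrier u j])
    also have "\<dots> = 0"
      using S by (intro sum.neutral) (auto simp: unit_vec_def)
    finally show "row_mult ?u ?S $ j = 0\<^sub>v n $ j"
      using j by simp
  qed (use stacked_carrier in simp)
  then have "?u = 0\<^sub>v (k * (\<delta> + 1))"
    by (rule indep_rowsD[OF ind stacked_carrier u])
  then have "?u $ r = 0\<^sub>v (k * (\<delta> + 1)) $ r" by simp
  then show False
    using r' by simp
qed

text \<open>Among the messages of words of minimal weight, one of least degree bound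
  \<open>L\<close> is taken; cutting it behind a vanishing window would contradict the choice of
  \<open>L\<close>.\<close>

lemma minimal_word_windows:
  assumes k: "0 < k" and ind: "indep_rows G"
    and d: "d = (LEAST d. \<exists>v\<in>poly_row_module G. v \<noteq> 0\<^sub>v n \<and> d = poly_weight v)"
  obtains \<alpha> L where "\<alpha> \<in> carrier_vec k" "\<alpha> \<noteq> 0\<^sub>v k" "\<And>i. i < k \<Longrightarrow> degree (\<alpha> $ i) \<le> L"
    "poly_weight (row_mult \<alpha> G) = d"
    "\<forall>s < L + \<delta> + 1. window \<alpha> s \<noteq> 0\<^sub>v (k * (\<delta> + 1))"
proof -
  have nz: "row_mult \<alpha> G \<noteq> 0\<^sub>v n" if "\<alpha> \<in> carrier_vec k" "\<alpha> \<noteq> 0\<^sub>v k" for \<alpha>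
    using indep_rowsD[OF ind G] that by blast
  have d_le: "d \<le> poly_weight (row_mult \<alpha> G)" if "\<alpha> \<in> carrier_vec k" "\<alpha> \<noteq> 0\<^sub>v k" for \<alpha>
    unfolding d using nz[OF that] that(1) G
    by (intro Least_le) (auto simp: poly_row_module_def)
  define P where "P L \<longleftrightarrow> (\<exists>\<alpha>. \<alpha> \<in> carrier_vec k \<and> \<alpha> \<noteq> 0\<^sub>v k \<and>
    (\<forall>i<k. degree (\<alpha> $ i) \<le> L) \<and> poly_weight (row_mult \<alpha> G) = d)" for L
  have "\<exists>L. P L"
  proof -
    let ?u = "unit_vec k 0 :: 'a poly vec"
    have "?u $ 0 \<noteq> 0\<^sub>v k $ 0"
      using k by simp
    then have "?u \<noteq> 0\<^sub>v k" by metis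
    then have "row_mult ?u G \<noteq> 0\<^sub>v n"
      by (intro nz) auto
    moreover have "row_mult ?u G \<in> poly_row_module G"
      using G by (auto simp: poly_row_module_def)
    ultimately have "\<exists>d. \<exists>v\<in>poly_row_module G. v \<noteq> 0\<^sub>v n \<and> d = poly_weight v"
      by blast
    then have "\<exists>v\<in>poly_row_module G. v \<noteq> 0\<^sub>v n \<and> d = poly_weight v"
      unfolding d by (rule LeastI_ex)
    then obtain \<alpha> where \<alpha>: "\<alpha> \<in> carrier_vec k" "row_mult \<alpha> G \<noteq> 0\<^sub>v n" "poly_weight (row_mult \<alpha> G) = d"
      using G by (auto simp: poly_row_module_def)
    have "\<alpha> \<noteq> 0\<^sub>v k"
      using \<alpha>(2) row_mult_zero[OF G] by blast
    moreover have "degree (\<alpha> $ i) \<le> (\<Sum>i<k. degree (\<alpha> $ i))" if "i < k" for i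
      using that by (intro member_le_sum) auto
    ultimately show ?thesis
      using \<alpha> unfolding P_def by blast
  qed
  define L where "L = (LEAST L. P L)"
  have "P L"
    unfolding L_def using \<open>\<exists>L. P L\<close> by (rule LeastI_ex)
  then obtain \<alpha> where \<alpha>: "\<alpha> \<in> carrier_vec k" "\<alpha> \<noteq> 0\<^sub>v k" "\<And>i. i < k \<Longrightarrow> degree (\<alpha> $ i) \<le> L"
    "poly_weight (row_mult \<alpha> G) = d"
    unfolding P_def by blast
  have L_min: "L \<le> L'" if "P L'" for L'
    unfolding L_def using that by (rule Least_le)
  \<comment> \<open>The least bound \<open>L\<close> is attained. For \<open>L = 0\<close> this
    rests on the message being nonzero, otherwise on the failure of \<open>P\<close> at the
    predecessor of \<open>L\<close>.\<close>
  have "\<exists>i<k. coeff (\<alpha> $ i) L \<noteq> 0"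
  proof (cases L)
    case 0
    obtain i where i: "i < k" "\<alpha> $ i \<noteq> 0"
      using \<alpha>(1,2) by (auto simp: vec_eq_iff)
    then have "degree (\<alpha> $ i) = L"
      using \<alpha>(3)[OF i(1)] 0 by simp
    then show ?thesis
      using i by (metis leading_coeff_0_iff)
  next
    case (Suc L')
    have "\<not> P L'"
      using L_min Suc by force
    then obtain i where i: "i < k" "\<not> degree (\<alpha> $ i) \<le> L'"
      using \<alpha>(1,2,4) unfolding P_def by blast
    then have "degree (\<alpha> $ i) = L"
      using \<alpha>(3)[OF i(1)] Suc by simp
    moreover have "\<alpha> $ i \<noteq> 0"
      using i by auto
    ultimately show ?thesis
      using i by (metis leading_coeff_0_iff)
  qed
  then obtain i where i: "i < k" "coeff (\<alpha> $ i) L \<noteq> 0" by blast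
  have "window \<alpha> s \<noteq> 0\<^sub>v (k * (\<delta> + 1))" if s: "s < L + \<delta> + 1" for s
  proof
    assume 0: "window \<alpha> s = 0\<^sub>v (k * (\<delta> + 1))"
    \<comment> \<open>Since s \<le> L + \<delta>, a window at some s \<ge> L would contain the
      nonzero coefficient at \<open>L\<close>. So a nonzero tail remains behind the window.\<close>
    have "s < L"
      using window_eq_0D[OF 0 i(1), of L] i(2) s by force
    let ?\<alpha> = "map_vec (poly_shift (Suc s)) \<alpha>"
    have \<alpha>': "?\<alpha> \<in> carrier_vec k"
      using \<alpha>(1) by simp
    have "coeff (?\<alpha> $ i) (L - Suc s) \<noteq> 0"
      using i \<alpha>(1) \<open>s < L\<close> by (simp add: coeff_poly_shift)
    then have nz': "?\<alpha> \<noteq> 0\<^sub>v k"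
      using i(1) by (metis coeff_0 index_zero_vec(1))
    \<comment> \<open>The shift does not increase the weight, and minimality of \<open>d\<close>
      then forces equality.\<close>
    have "poly_weight (row_mult ?\<alpha> G) \<le> d"
      unfolding row_mult_shift[OF \<alpha>(1) 0] \<alpha>(4)[symmetric] by (rule poly_weight_shift_le)
    then have "poly_weight (row_mult ?\<alpha> G) = d"
      using d_le[OF \<alpha>' nz'] by simp
    moreover have "degree (?\<alpha> $ r) \<le> L - Suc s" if "r < k" for r
    proof (rule degree_le, intro allI impI)
      fix t assume "L - Suc s < t"
      then have "degree (\<alpha> $ r) < t + Suc s"
        using \<alpha>(3)[OF that] by linarith
      then show "coeff (?\<alpha> $ r) t = 0"
        using that \<alpha>(1) by (simp add: coeff_poly_shift coeff_eq_0)
    qed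
    ultimately have "P (L - Suc s)"
      unfolding P_def using \<alpha>' nz' by blast
    then have "L \<le> L - Suc s"
      by (rule L_min)
    then show False
      using \<open>s < L\<close> by simp
  qed
  then show thesis
    using that \<alpha> by blast
qed

text \<open>Each of the L + \<delta> + 1 coefficients of the codeword is the image of a nonzero
  window and contributes at least \<mu>.\<close>

lemma poly_weight_windows_ge:
  assumes ind: "indep_rows (stacked_matrix G \<delta>)"
    and \<alpha>: "\<alpha> \<in> carrier_vec k" "\<And>i. i < k \<Longrightarrow> degree (\<alpha> $ i) \<le> L"
    and win: "\<And>s. s < L + \<delta> + 1 \<Longrightarrow> window \<alpha> s \<noteq> 0\<^sub>v (k * (\<delta> + 1))"
  shows "min_distance (stacked_code G \<delta>) * (L + \<delta> + 1) \<le> poly_weight (row_mult \<alpha> G)"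
proof -
  let ?\<mu> = "min_distance (stacked_code G \<delta>)"
  have "?\<mu> * (L + \<delta> + 1) = (\<Sum>s<L + \<delta> + 1. ?\<mu>)" by simp
  also have "\<dots> \<le> (\<Sum>s<L + \<delta> + 1. hamming_weight (map_vec (\<lambda>p. coeff p s) (row_mult \<alpha> G)))"
  proof (rule sum_mono)
    fix s assume "s \<in> {..<L + \<delta> + 1}"
    then show "?\<mu> \<le> hamming_weight (map_vec (\<lambda>p. coeff p s) (row_mult \<alpha> G))"
      unfolding coeff_row_mult_window[OF \<alpha>(1)]
      by (intro min_distance_stacked_le[OF ind] win) (auto simp: window_def)
  qed
  also have "\<dots> = poly_weight (row_mult \<alpha> G)"
    using degree_row_mult[OF \<alpha>(1) _ \<alpha>(2)] G
    by (intro poly_weight_eq[symmetric]) (auto simp: less_Suc_eq_le)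
  finally show ?thesis .
qed

section \<open>Row distances as weights of polynomial words\<close>

lemma row_space_sliding:
  "vec_space.row_space (dim_col G * (\<delta> + l + 1)) (sliding_matrix G \<delta> l) =
    (\<lambda>a. row_mult a (sliding_matrix G \<delta> l)) ` carrier_vec (k * (l + 1))"
proof -
  have S: "sliding_matrix G \<delta> l \<in> carrier_mat (k * (l + 1)) (dim_col G * (\<delta> + l + 1))"
    using sliding_carrier[of l] G by simp
  show ?thesis
    unfolding vec_space.row_space_eq[OF S] using S by (auto simp: row_mult_def)
qed

text \<open>A word of minimal weight in the sliding code is pulled back to a polynomial message, so
  the row distance is bounded below by the free distance.\<close>

lemma row_distance_attained:
  assumes k: "0 < k" and ind: "indep_rows G"
  obtains \<alpha> where "\<alpha> \<in> carrier_vec k" "\<alpha> \<noteq> 0\<^sub>v k" "row_distance G \<delta> l = poly_weight (row_mult \<alpha> G)"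
proof -
  let ?S = "sliding_matrix G \<delta> l" and ?N = "n * (\<delta> + l + 1)"
  let ?B = "(\<lambda>a. row_mult a ?S) ` carrier_vec (k * (l + 1))"
  have sub: "?B \<subseteq> carrier_vec ?N"
    using row_mult_carrier[OF sliding_carrier] by auto
  have diff: "u - v \<in> ?B" if "u \<in> ?B" "v \<in> ?B" for u v
  proof -
    obtain a b where ab: "a \<in> carrier_vec (k * (l + 1))" "b \<in> carrier_vec (k * (l + 1))"
      "u = row_mult a ?S" "v = row_mult b ?S"
      using \<open>u \<in> ?B\<close> \<open>v \<in> ?B\<close> by auto
    then show ?thesis
      using row_mult_diff[OF sliding_carrier ab(1,2)]
      by (intro image_eqI[of _ _ "a - b"]) auto
  qed
  let ?u = "unit_vec k 0 :: 'a poly vec"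
  have u: "?u \<in> carrier_vec k" "degree (?u $ i) \<le> l" if "i < k" for i
    using that by (auto simp: unit_vec_def)
  have "?u $ 0 \<noteq> 0\<^sub>v k $ 0"
    using k by simp
  then have "?u \<noteq> 0\<^sub>v k" by metis
  then have "row_mult ?u G \<noteq> 0\<^sub>v n"
    using indep_rowsD[OF ind G, of ?u] by auto
  then have "row_mult (block_message l ?u) ?S \<noteq> 0\<^sub>v ?N"
    using sliding_row_mult_eq_0_iff[of ?u l] u k by auto
  moreover have "row_mult (block_message l ?u) ?S \<in> ?B"
    using block_message_carrier by blast
  ultimately obtain v where v: "v \<in> ?B" "v \<noteq> 0\<^sub>v ?N" "hamming_weight v = min_distance ?B"
    using min_distance_attained[OF sub diff] by blast
  then obtain a where a: "a \<in> carrier_vec (k * (l + 1))" "v = row_mult a ?S"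
    by blast
  obtain \<alpha> where \<alpha>: "\<alpha> \<in> carrier_vec k" "\<And>i. i < k \<Longrightarrow> degree (\<alpha> $ i) \<le> l" "block_message l \<alpha> = a"
    by (rule block_message_surj[OF a(1)]) blast
  have "row_mult \<alpha> G \<noteq> 0\<^sub>v n"
    using sliding_row_mult_eq_0_iff[OF \<alpha>(1,2)] v(2) a(2) \<alpha>(3) by simp
  then have "\<alpha> \<noteq> 0\<^sub>v k"
    using row_mult_zero[OF G] by blast
  moreover have "row_distance G \<delta> l = poly_weight (row_mult \<alpha> G)"
    using hamming_weight_sliding[OF \<alpha>(1,2)] v(3) a(2) \<alpha>(3)
    by (simp only: row_distance_def row_space_sliding)
  ultimately show thesis
    using that \<alpha>(1) by blast
qed

lemma row_distance_le:
  assumes ind: "indep_rows G"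
    and \<alpha>: "\<alpha> \<in> carrier_vec k" "\<alpha> \<noteq> 0\<^sub>v k" "\<And>i. i < k \<Longrightarrow> degree (\<alpha> $ i) \<le> l"
  shows "row_distance G \<delta> l \<le> poly_weight (row_mult \<alpha> G)"
proof -
  let ?S = "sliding_matrix G \<delta> l" and ?N = "n * (\<delta> + l + 1)"
  let ?B = "(\<lambda>a. row_mult a ?S) ` carrier_vec (k * (l + 1))"
  have "min_distance ?B \<le> hamming_weight (row_mult (block_message l \<alpha>) ?S)"
  proof (rule min_distance_le)
    show "row_mult (block_message l \<alpha>) ?S \<in> ?B"
      using block_message_carrier by blast
    have "row_mult (0\<^sub>v (k * (l + 1))) ?S = 0\<^sub>v ?N"
      by (rule row_mult_zero[OF sliding_carrier])
    then show "0\<^sub>v ?N \<in> ?B"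
      by (metis image_eqI zero_carrier_vec)
    show "row_mult (block_message l \<alpha>) ?S \<in> carrier_vec ?N"
      by (rule row_mult_carrier[OF sliding_carrier])
    show "row_mult (block_message l \<alpha>) ?S \<noteq> 0\<^sub>v ?N"
      using sliding_row_mult_eq_0_iff[OF \<alpha>(1,3)] indep_rowsD[OF ind G \<alpha>(1)] \<alpha>(2) by blast
  qed
  then show ?thesis
    using hamming_weight_sliding[OF \<alpha>(1,3)] by (simp only: row_distance_def row_space_sliding)
qed

section \<open>Upper bounds for the free distance\<close>

lemma stacked_indep_dim:
  assumes "indep_rows (stacked_matrix G \<delta>)"
  shows "k * (\<delta> + 1) \<le> n"
proof (rule ccontr)
  assume "\<not> ?thesis"
  then obtain x where "x \<in> carrier_vec (k * (\<delta> + 1))" "x \<noteq> 0\<^sub>v (k * (\<delta> + 1))"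
    "row_mult x (stacked_matrix G \<delta>) = 0\<^sub>v n"
    using nontrivial_left_kernel[OF stacked_carrier] by (metis not_le)
  then show False
    using indep_rowsD[OF assms stacked_carrier] by blast
qed

text \<open>For \<delta> = 0 all products with constant messages are constant. A nonzero constant
  message can be chosen in the left kernel of the first k - 1 columns, which leaves at most n - k +
  1 nonzero coordinates.\<close>

lemma singleton_bound:
  assumes k: "0 < k" "k \<le> n" and \<delta>: "\<delta> = 0"
  obtains \<alpha> where "\<alpha> \<in> carrier_vec k" "\<alpha> \<noteq> 0\<^sub>v k" "poly_weight (row_mult \<alpha> G) \<le> n - k + 1"
proof -
  let ?A = "mat k (k - 1) (\<lambda>(i, j). coeff (G $$ (i, j)) 0)"
  have A: "?A \<in> carrier_mat k (k - 1)" by simp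
  obtain x where x: "x \<in> carrier_vec k" "x \<noteq> 0\<^sub>v k" "row_mult x ?A = 0\<^sub>v (k - 1)"
    by (rule nontrivial_left_kernel[OF A]) (use k in auto)
  let ?\<alpha> = "map_vec (\<lambda>c. [:c:]) x"
  have \<alpha>: "?\<alpha> \<in> carrier_vec k"
    using x(1) by simp
  obtain i where i: "i < k" "x $ i \<noteq> 0"
    using x(1,2) by (auto simp: vec_eq_iff)
  then have "?\<alpha> $ i \<noteq> 0\<^sub>v k $ i"
    using x(1) by simp
  then have "?\<alpha> \<noteq> 0\<^sub>v k" by metis
  moreover have "poly_weight (row_mult ?\<alpha> G) \<le> n - k + 1"
  proof -
    have card: "card {s. coeff (row_mult ?\<alpha> G $ j) s \<noteq> 0} \<le> of_bool (k - 1 \<le> j)" if j: "j < n" for j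
    proof -
      have "degree (row_mult ?\<alpha> G $ j) \<le> 0 + \<delta>"
        by (rule degree_row_mult[OF \<alpha> j]) (use x(1) in simp)
      then have "card {s. coeff (row_mult ?\<alpha> G $ j) s \<noteq> 0} = of_bool (coeff (row_mult ?\<alpha> G $ j) 0 \<noteq> 0)"
        using card_coeff_neq_0[of "row_mult ?\<alpha> G $ j" 1] \<delta> by simp
      moreover have "coeff (row_mult ?\<alpha> G $ j) 0 = 0" if "j < k - 1"
      proof -
        have "coeff (row_mult ?\<alpha> G $ j) 0 = (\<Sum>i<k. x $ i * coeff (G $$ (i, j)) 0)"
          using x(1) by (simp add: coeff_row_mult[OF \<alpha> j])
        also have "\<dots> = row_mult x ?A $ j"
          unfolding row_mult_index[OF A x(1) that] using that by (intro sum.cong) auto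
        also have "\<dots> = 0"
          using that by (simp only: x(3) index_zero_vec)
        finally show ?thesis .
      qed
      ultimately show ?thesis
        by (cases "k - 1 \<le> j") auto
    qed
    have "poly_weight (row_mult ?\<alpha> G) = (\<Sum>j<n. card {s. coeff (row_mult ?\<alpha> G $ j) s \<noteq> 0})"
      using G by (simp add: poly_weight_def)
    also have "\<dots> \<le> (\<Sum>j<n. of_bool (k - 1 \<le> j))"
      using card by (intro sum_mono) simp
    also have "\<dots> = card ({..<n} \<inter> {j. k - 1 \<le> j})"
      by simp
    also have "{..<n} \<inter> {j. k - 1 \<le> j} = {k - 1..<n}"
      by auto
    also have "card {k - 1..<n} = n - k + 1"
      using k by simp
    finally show ?thesis .
  qed
  ultimately show thesis
    using that \<alpha> by blast
qed

text \<open>The only row of \<open>G\<close> is itself a word, with \<open>n\<close> entries of at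
  most \<delta> + 1 coefficients each. For \<open>k = 1\<close> this is the generalised Singleton
  bound.\<close>

lemma single_row_weight_le:
  assumes k: "k = 1"
  obtains \<alpha> where "\<alpha> \<in> carrier_vec k" "\<alpha> \<noteq> 0\<^sub>v k" "poly_weight (row_mult \<alpha> G) \<le> n * (\<delta> + 1)"
proof -
  let ?\<alpha> = "unit_vec k 0 :: 'a poly vec"
  have \<alpha>: "?\<alpha> \<in> carrier_vec k" by simp
  have "?\<alpha> $ 0 \<noteq> 0\<^sub>v k $ 0"
    using k by simp
  then have "?\<alpha> \<noteq> 0\<^sub>v k" by metis
  moreover have "poly_weight (row_mult ?\<alpha> G) \<le> n * (\<delta> + 1)"
  proof -
    have card: "card {s. coeff (row_mult ?\<alpha> G $ j) s \<noteq> 0} \<le> \<delta> + 1" if j: "j < n" for j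
    proof -
      have "degree (row_mult ?\<alpha> G $ j) \<le> 0 + \<delta>"
        by (rule degree_row_mult[OF \<alpha> j]) (auto simp: unit_vec_def)
      then have "{s. coeff (row_mult ?\<alpha> G $ j) s \<noteq> 0} \<subseteq> {..\<delta>}"
        using le_degree le_trans by fastforce
      then have "card {s. coeff (row_mult ?\<alpha> G $ j) s \<noteq> 0} \<le> card {..\<delta>}"
        by (intro card_mono) auto
      then show ?thesis by simp
    qed
    have "poly_weight (row_mult ?\<alpha> G) = (\<Sum>j<n. card {s. coeff (row_mult ?\<alpha> G $ j) s \<noteq> 0})"
      using G by (simp add: poly_weight_def)
    also have "\<dots> \<le> (\<Sum>j<n. \<delta> + 1)"
      using card by (intro sum_mono) simp
    finally show ?thesis by simp
  qed
  ultimately show thesis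
    using that \<alpha> by blast
qed

end

section \<open>The free distance as a row distance\<close>

text \<open>Real floors become natural division; \<open>k \<le> n\<close> makes the natural
  difference \<open>n - k\<close> agree with the real one.\<close>

lemma row_index_eq:
  assumes "k \<le> n"
  shows "row_index n k \<delta> \<mu> = int (((n - k) * (\<delta> div k + 1) + \<delta> + 1) div \<mu>) - (int \<delta> + 1)"
proof -
  let ?B = "(n - k) * (\<delta> div k + 1) + \<delta> + 1"
  have "(real n - real k) * (real_of_int \<lfloor>real \<delta> / real k\<rfloor> + 1) + real \<delta> + 1 = real ?B"
    by (simp only: floor_divide_of_nat_eq of_nat_add of_nat_mult of_nat_diff[OF assms] of_nat_1
      of_int_of_nat_eq)
  then have "row_index n k \<delta> \<mu> = \<lfloor>real ?B / real \<mu>\<rfloor> - (int \<delta> + 1)"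
    by (simp only: row_index_def times_divide_eq_left mult_1)
  then show ?thesis
    by (simp only: floor_divide_of_nat_eq)
qed

text \<open>The first conjunct certifies that \<open>nat\<close> does not truncate a negative
  index.\<close>

theorem theorem3p1:
  fixes C :: "'a :: {finite, field} poly fract vec set"
    and G :: "'a poly mat"
    and n k \<delta> \<nu> \<mu> :: nat
  assumes "0 < k"
    and "convolutional_code n k C"
    and "\<delta> = code_degree n k C"
    and "canonical_generator_matrix n k C G"
    and "\<nu> = vec_dim n (stacked_code G \<delta>)"
    and "\<mu> = min_distance (stacked_code G \<delta>)"
    and "\<nu> = k * (\<delta> + 1)"
  shows "0 \<le> row_index n k \<delta> \<mu>
    \<and> free_distance n k C = row_distance G \<delta> (nat (row_index n k \<delta> \<mu>))"
proof -
  have C: "vec_subspace n C"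
    using assms(2) by (simp add: convolutional_code_def)
  \<comment> \<open>\<open>G\<close> witnesses that canonical matrices exist, so the chosen one is
    canonical and the invariance results carry degree and free distance over to
    \<open>G\<close>.\<close>
  have some: "canonical_generator_matrix n k C (some_canonical n k C)"
    unfolding some_canonical_def using assms(4) by (rule someI)
  have "row_degree_sum G = \<delta>"
    using canonical_generator_matrix_invariants(1)[OF C assms(4) some] assms(3)
    by (simp add: code_degree_def)
  have gen: "generator_matrix n k C G"
    using assms(4) by (simp add: canonical_generator_matrix_def)
  note G = generator_matrixD(1)[OF C gen] and ind = generator_matrixD(4)[OF C gen]
  have row_le: "row_degree G i \<le> \<delta>" if "i < k" for i
  proof -
    have "row_degree G i \<le> (\<Sum>i<k. row_degree G i)"
      using that by (intro member_le_sum) auto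
    then show ?thesis
      using \<open>row_degree_sum G = \<delta>\<close> G by (simp add: row_degree_sum_def)
  qed
  have deg: "degree (G $$ (i, j)) \<le> \<delta>" if "i < k" "j < n" for i j
    using row_degree_ge[of j G i] row_le[of i] that G by force
  have S: "stacked_matrix G \<delta> \<in> carrier_mat (k * (\<delta> + 1)) n"
    by (rule stacked_carrier[OF G deg])
  have indS: "indep_rows (stacked_matrix G \<delta>)"
    using full_dim_indep_rows[OF S] assms(5,7) stacked_code_eq[OF G deg] by simp
  have "k \<le> n"
    using stacked_indep_dim[OF G deg indS] by simp
  \<comment> \<open>Every row degree is at least \<delta>, and they sum to \<delta>, so k \<delta>
    \<le> \<delta>.\<close>
  have "k = 1 \<or> \<delta> = 0"
  proof -
    have "\<delta> \<le> row_degree G i" if i: "i < k" for i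
      using stacked_indep_degree[OF G deg indS i] row_degree_ge[of _ G i] G by force
    then have "(\<Sum>i<k. \<delta>) \<le> (\<Sum>i<k. row_degree G i)"
      by (intro sum_mono) simp
    then have "k * \<delta> \<le> \<delta>"
      using \<open>row_degree_sum G = \<delta>\<close> G by (simp add: row_degree_sum_def)
    then show ?thesis
      using assms(1) by (cases "k = 1") auto
  qed
  define d where "d = (LEAST d. \<exists>v\<in>poly_row_module G. v \<noteq> 0\<^sub>v n \<and> d = poly_weight v)"
  have free: "free_distance n k C = d"
    using canonical_generator_matrix_invariants(2)[OF C assms(4) some]
    by (simp add: free_distance_def d_def)
  have d_le: "d \<le> poly_weight (row_mult \<alpha> G)" if "\<alpha> \<in> carrier_vec k" "\<alpha> \<noteq> 0\<^sub>v k" for \<alpha>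
  proof -
    have "row_mult \<alpha> G \<noteq> 0\<^sub>v n"
      using indep_rowsD[OF ind G that(1)] that(2) by blast
    then show ?thesis
      unfolding d_def using that(1) G by (intro Least_le) (auto simp: poly_row_module_def)
  qed
  define B where "B = (n - k) * (\<delta> div k + 1) + \<delta> + 1"
  have "d \<le> B"
  proof (cases "\<delta> = 0")
    case True
    obtain \<alpha> where "\<alpha> \<in> carrier_vec k" "\<alpha> \<noteq> 0\<^sub>v k" "poly_weight (row_mult \<alpha> G) \<le> n - k + 1"
      by (rule singleton_bound[OF G deg assms(1) \<open>k \<le> n\<close> True])
    then show ?thesis
      using d_le[of \<alpha>] True by (simp add: B_def)
  next
    case False
    then have k: "k = 1"
      using \<open>k = 1 \<or> \<delta> = 0\<close> by simp
    obtain \<alpha> where "\<alpha> \<in> carrier_vec k" "\<alpha> \<noteq> 0\<^sub>v k" "poly_weight (row_mult \<alpha> G) \<le> n * (\<delta> + 1)"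
      by (rule single_row_weight_le[OF G deg k])
    then have "d \<le> n * (\<delta> + 1)"
      using d_le[of \<alpha>] by simp
    \<comment> \<open>With \<open>k = 1\<close> the bound reads (n - 1) (\<delta> + 1) + \<delta> +
      1.\<close>
    also have "\<dots> = B"
      using k \<open>k \<le> n\<close> by (cases n) (simp_all add: B_def)
    finally show ?thesis .
  qed
  obtain \<alpha> L where \<alpha>: "\<alpha> \<in> carrier_vec k" "\<alpha> \<noteq> 0\<^sub>v k" "\<And>i. i < k \<Longrightarrow> degree (\<alpha> $ i) \<le> L"
    "poly_weight (row_mult \<alpha> G) = d"
    and win: "\<forall>s < L + \<delta> + 1. window k \<delta> \<alpha> s \<noteq> 0\<^sub>v (k * (\<delta> + 1))"
    by (rule minimal_word_windows[OF G deg assms(1) ind d_def]; blast)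
  have "\<mu> * (L + \<delta> + 1) \<le> B"
    using poly_weight_windows_ge[OF G deg indS \<alpha>(1,3)] win \<alpha>(4) \<open>d \<le> B\<close> assms(6) by simp
  moreover have "0 < \<mu>"
    using min_distance_stacked_pos[OF G deg assms(1) indS] assms(6) by simp
  ultimately have "L + \<delta> + 1 \<le> B div \<mu>"
    by (simp add: less_eq_div_iff_mult_less_eq mult.commute)
  then have L: "int L \<le> row_index n k \<delta> \<mu>"
    unfolding row_index_eq[OF \<open>k \<le> n\<close>] B_def by linarith
  define l where "l = nat (row_index n k \<delta> \<mu>)"
  have "L \<le> l"
    using L by (simp add: l_def)
  \<comment> \<open>The minimal word has a message of degree at most \<open>L\<close>, hence at most
    \<open>l\<close>, so it competes in the row distance at \<open>l\<close>.\<close>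
  then have "row_distance G \<delta> l \<le> d"
    using row_distance_le[OF G deg ind \<alpha>(1,2), of l] \<alpha>(3,4) le_trans by metis
  moreover have "d \<le> row_distance G \<delta> l"
  proof -
    obtain \<beta> where "\<beta> \<in> carrier_vec k" "\<beta> \<noteq> 0\<^sub>v k"
      "row_distance G \<delta> l = poly_weight (row_mult \<beta> G)"
      by (rule row_distance_attained[OF G deg assms(1) ind])
    then show ?thesis
      using d_le[of \<beta>] by simp
  qed
  ultimately show ?thesis
    using L free by (simp add: l_def)
qed

end
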